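(* Let $r \ge 3$ be an integer, $I = \{0, 1, \dots, r-1\}$, and let $(G^+, R)$ be a $C^+$-group of rank $r$, with $R = \{\alpha_1,\dots,\alpha_{r-1}\}$. Put $G^+_i := \langle \alpha_j \mid 1 \le j \le r-1,\ j \ne i\rangle$ for $i = 1,\dots,r-1$ and $G^+_0 := \langle \alpha_1^{-1}\alpha_j \mid 2 \le j \le r-1\rangle$, and let $\Gamma = \Gamma(G^+; (G^+_i)_{i \in I})$ be the coset geometry associated to $(G^+,R)$. Then $\Gamma$ is a chiral hypertope if and only if all of the following conditions hold: (i) for every $k \in I$, writing $J := I \setminus \{k\}$, the group $G^+$ acts transitively on the chambers of the $(r-1)$-truncation ${}^J\Gamma = \Gamma(G^+; (G^+_i)_{i \in J})$; (ii) $\bigcap_{t \in T} G^+_t = \{1_{G^+}\}$ for each subset $T \subset I$ with $|T| = r-1$; (iii) $\left| \bigcap_{j \in I \setminus \{k\}} (G^+_k G^+_j) \right| = 2\,|G^+_k|$ for some $k \in I$; (iv) there is no automorphism of $G^+$ that inverts all elements of $R$ (i.e. no $\varphi \in \mathrm{Aut}(G^+)$ with $\varphi(\alpha) = \alpha^{-1}$ for all $\alpha \in R$).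
   Context: Incidence systems. An incidence system is a 4-tuple $\Gamma = (X, *, t, I)$ where $X$ is a set (of elements), $I$ is a set (of types), $t : X \to I$ is a type function, and $*$ is a reflexive symmetric relation on $X$ (incidence) such that $x * y$ and $t(x) = t(y)$ imply $x = y$. Its rank is $|I|$. A flag is a set of pairwise incident elements; the type of a flag $F$ is $t(F)$; a chamber is a flag of type $I$. $\Gamma$ is a geometry if every flag is contained in a chamber. For a flag $F$ of a geometry, the residue $\Gamma_F$ is the geometry on the set of elements $x \notin F$ incident to all elements of $F$, with type set $I \setminus t(F)$ and the restricted type function and incidence; the residue of the empty flag is $\Gamma$ itself. The incidence graph has vertex set $X$, two distinct vertices being joined when incident. $\Gamma$ is residually connected if every residue of rank at least two (including $\Gamma$ itself) has a connected incidence graph. $\Gamma$ is thin if every residue of rank one contains exactly two elements. For $J \subseteq I$, the $J$-truncation ${}^J\Gamma$ is the incidence system obtained by keeping only the elements whose type lies in $J$, with the restricted type function and incidence; its rank is $|J|$. $\mathrm{Aut}_I(\Gamma)$ is the group of type-preserving automorphisms, i.e. permutations $\alpha$ of $X$ with $t(\alpha(x)) = t(x)$ and $x * y \Leftrightarrow \alpha(x) * \alpha(y)$. Two chambers are adjacent if they differ in exactly one element. A geometry $\Gamma$ is chiral if $\mathrm{Aut}_I(\Gamma)$ has two orbits on the chambers such that any two adjacent chambers lie in distinct orbits. A hypertope is a thin, residually connected geometry. A chiral hypertope is a hypertope that is a chiral geometry. Coset incidence systems. For a group $G$ with a family of subgroups $(G_i)_{i \in I}$, the coset incidence system $\Gamma(G;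 (G_i)_{i \in I})$ has as elements of type $i$ the right cosets $G_i g$ ($g \in G$), with $G_i g_1 * G_j g_2$ if and only if $G_i g_1 \cap G_j g_2 \ne \emptyset$. The group $G$ acts on it by right multiplication as type-preserving automorphisms. If it is a geometry it is called a coset geometry. Products such as $G_kG_j$ are set products $\{xy : x \in G_k, y \in G_j\}$. $C^+$-groups. A pair $(G^+, R)$ consists of a group $G^+$ and a set $R = \{\alpha_1, \dots, \alpha_{r-1}\}$ of generators of $G^+$; its rank is $r$. Put $\alpha_0 := 1_{G^+}$ and $\alpha_{ij} := \alpha_i^{-1}\alpha_j$ for $0 \le i,j \le r-1$, and for $J \subseteq \{0,\dots,r-1\}$ let $H_J := \langle \alpha_{ij} \mid i,j \in J\rangle$. The pair $(G^+,R)$ is a $C^+$-group if $H_J \cap H_K = H_{J \cap K}$ for all $J, K \subseteq \{0,\dots,r-1\}$ with $|J|,|K| \ge 2$.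
   Formalization: In (iii), when G⁺_k is infinite, the equation |S| = 2|G⁺_k| is replaced by "S contains exactly two right cosets of G⁺_k", since the cardinal equation then does not force thinness (fails e.g. for BS(1,2) with r = 3); for finite G⁺_k it is the stated equation. *)

theory Defs
  imports "HOL-Algebra.Generated_Groups" "HOL-Algebra.Group_Action"
begin

section \<open>Incidence systems and geometries\<close>

record ('x, 'i) incidence_system =
  elems :: "'x set"
  incidence :: "('x \<times> 'x) set"
  type_of :: "'x \<Rightarrow> 'i"
  type_set :: "'i set"

definition is_incidence_system :: "('x, 'i) incidence_system \<Rightarrow> bool" where
  "is_incidence_system \<Gamma> \<longleftrightarrow>
     type_of \<Gamma> \<in> elems \<Gamma> \<rightarrow> type_set \<Gamma> \<and>
     incidence \<Gamma> \<subseteq> elems \<Gamma> \<times> elems \<Gamma> \<and>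
     refl_on (elems \<Gamma>) (incidence \<Gamma>) \<and>
     sym (incidence \<Gamma>) \<and>
     (\<forall>(x, y) \<in> incidence \<Gamma>. type_of \<Gamma> x = type_of \<Gamma> y \<longrightarrow> x = y)"

definition rank :: "('x, 'i) incidence_system \<Rightarrow> nat" where
  "rank \<Gamma> = card (type_set \<Gamma>)"

definition flag :: "('x, 'i) incidence_system \<Rightarrow> 'x set \<Rightarrow> bool" where
  "flag \<Gamma> F \<longleftrightarrow> F \<subseteq> elems \<Gamma> \<and> (\<forall>x\<in>F. \<forall>y\<in>F. (x, y) \<in> incidence \<Gamma>)"

definition chambers :: "('x, 'i) incidence_system \<Rightarrow> 'x set set" where
  "chambers \<Gamma> = {C. flag \<Gamma> C \<and> type_of \<Gamma> ` C = type_set \<Gamma>}"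

definition geometry :: "('x, 'i) incidence_system \<Rightarrow> bool" where
  "geometry \<Gamma> \<longleftrightarrow>
     is_incidence_system \<Gamma> \<and> (\<forall>F. flag \<Gamma> F \<longrightarrow> (\<exists>C\<in>chambers \<Gamma>. F \<subseteq> C))"

definition residue :: "('x, 'i) incidence_system \<Rightarrow> 'x set \<Rightarrow> ('x, 'i) incidence_system" where
  "residue \<Gamma> F =
     (let X = {x \<in> elems \<Gamma> - F. \<forall>y\<in>F. (x, y) \<in> incidence \<Gamma>}
      in \<lparr>elems = X, incidence = incidence \<Gamma> \<inter> X \<times> X, type_of = type_of \<Gamma>,
          type_set = type_set \<Gamma> - type_of \<Gamma> ` F\<rparr>)"

definition truncation :: "'i set \<Rightarrow> ('x, 'i) incidence_system \<Rightarrow> ('x, 'i) incidence_system" where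
  "truncation J \<Gamma> =
     (let X = {x \<in> elems \<Gamma>. type_of \<Gamma> x \<in> J}
      in \<lparr>elems = X, incidence = incidence \<Gamma> \<inter> X \<times> X, type_of = type_of \<Gamma>, type_set = J\<rparr>)"

definition incidence_graph_edges :: "('x, 'i) incidence_system \<Rightarrow> ('x \<times> 'x) set" where
  "incidence_graph_edges \<Gamma> = {(x, y) \<in> incidence \<Gamma>. x \<noteq> y}"

definition connected_incidence_graph :: "('x, 'i) incidence_system \<Rightarrow> bool" where
  "connected_incidence_graph \<Gamma> \<longleftrightarrow>
     (\<forall>x\<in>elems \<Gamma>. \<forall>y\<in>elems \<Gamma>. (x, y) \<in> (incidence_graph_edges \<Gamma>)\<^sup>*)"

definition residually_connected :: "('x, 'i) incidence_system \<Rightarrow> bool" where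
  "residually_connected \<Gamma> \<longleftrightarrow>
     (\<forall>F. flag \<Gamma> F \<and> rank (residue \<Gamma> F) \<ge> 2 \<longrightarrow> connected_incidence_graph (residue \<Gamma> F))"

definition thin :: "('x, 'i) incidence_system \<Rightarrow> bool" where
  "thin \<Gamma> \<longleftrightarrow>
     (\<forall>F. flag \<Gamma> F \<and> rank (residue \<Gamma> F) = 1 \<longrightarrow> card (elems (residue \<Gamma> F)) = 2)"

definition hypertope :: "('x, 'i) incidence_system \<Rightarrow> bool" where
  "hypertope \<Gamma> \<longleftrightarrow> geometry \<Gamma> \<and> thin \<Gamma> \<and> residually_connected \<Gamma>"


section \<open>Type-preserving automorphisms and chirality\<close>

definition AutI :: "('x, 'i) incidence_system \<Rightarrow> ('x \<Rightarrow> 'x) monoid" where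
  "AutI \<Gamma> = BijGroup (elems \<Gamma>)
     \<lparr>carrier := {\<alpha> \<in> Bij (elems \<Gamma>).
        (\<forall>x\<in>elems \<Gamma>. type_of \<Gamma> (\<alpha> x) = type_of \<Gamma> x) \<and>
        (\<forall>x\<in>elems \<Gamma>. \<forall>y\<in>elems \<Gamma>.
            (x, y) \<in> incidence \<Gamma> \<longleftrightarrow> (\<alpha> x, \<alpha> y) \<in> incidence \<Gamma>)}\<rparr>"

definition chamber_action :: "('x, 'i) incidence_system \<Rightarrow> ('x \<Rightarrow> 'x) \<Rightarrow> 'x set \<Rightarrow> 'x set" where
  "chamber_action \<Gamma> \<alpha> = (\<lambda>C\<in>chambers \<Gamma>. \<alpha> ` C)"

definition adjacent :: "'x set \<Rightarrow> 'x set \<Rightarrow> bool" where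
  "adjacent C D \<longleftrightarrow> card (C - D) = 1 \<and> card (D - C) = 1"

definition chiral :: "('x, 'i) incidence_system \<Rightarrow> bool" where
  "chiral \<Gamma> \<longleftrightarrow>
     card (orbits (AutI \<Gamma>) (chambers \<Gamma>) (chamber_action \<Gamma>)) = 2 \<and>
     (\<forall>C\<in>chambers \<Gamma>. \<forall>D\<in>chambers \<Gamma>. adjacent C D \<longrightarrow>
        orbit (AutI \<Gamma>) (chamber_action \<Gamma>) C \<noteq> orbit (AutI \<Gamma>) (chamber_action \<Gamma>) D)"

definition chiral_hypertope :: "('x, 'i) incidence_system \<Rightarrow> bool" where
  "chiral_hypertope \<Gamma> \<longleftrightarrow> hypertope \<Gamma> \<and> chiral \<Gamma>"


section \<open>Coset incidence systems\<close>

text \<open>An element of type \<open>i\<close> is a pair \<open>(i, C)\<close>, because one and the same set \<open>C\<close> may be a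
  coset of several of the subgroups.\<close>

definition coset_system ::
    "('a, 'b) monoid_scheme \<Rightarrow> 'i set \<Rightarrow> ('i \<Rightarrow> 'a set) \<Rightarrow> ('i \<times> 'a set, 'i) incidence_system" where
  "coset_system G I H =
     (let X = (SIGMA i:I. rcosets\<^bsub>G\<^esub> (H i))
      in \<lparr>elems = X, incidence = {(x, y). x \<in> X \<and> y \<in> X \<and> snd x \<inter> snd y \<noteq> {}},
          type_of = fst, type_set = I\<rparr>)"

definition right_mult ::
    "('a, 'b) monoid_scheme \<Rightarrow> 'a \<Rightarrow> 'i \<times> 'a set \<Rightarrow> 'i \<times> 'a set" where
  "right_mult G g x = (fst x, snd x #>\<^bsub>G\<^esub> g)"

definition transitive_on_chambers ::
    "('a, 'b) monoid_scheme \<Rightarrow> ('i \<times> 'a set, 'i) incidence_system \<Rightarrow> bool" where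
  "transitive_on_chambers G \<Gamma> \<longleftrightarrow>
     (\<forall>C\<in>chambers \<Gamma>. \<forall>D\<in>chambers \<Gamma>. \<exists>g\<in>carrier G. right_mult G g ` C = D)"

text \<open>\<open>|S| = 2|H|\<close> for a union \<open>S\<close> of right cosets of a subgroup \<open>H\<close>.  Equality of infinite
  cardinals would not bound the number of cosets contained in \<open>S\<close>, and \<open>card\<close> is \<open>0\<close> on infinite
  sets; so for infinite \<open>H\<close> the equation is read as \<open>S\<close> consisting of two cosets of \<open>H\<close>.  The
  lemma \<open>card_cosets_contained\<close> below shows that for finite \<open>H\<close> this is the same as the equation
  of cardinalities.\<close>

definition twice_as_large :: "('a, 'b) monoid_scheme \<Rightarrow> 'a set \<Rightarrow> 'a set \<Rightarrow> bool" where
  "twice_as_large G S H \<longleftrightarrow>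
     (if finite H then card S = 2 * card H
      else card {C \<in> rcosets\<^bsub>G\<^esub> H. C \<subseteq> S} = 2)"

lemma (in group) card_cosets_contained:
  assumes H: "subgroup H G" and fin: "finite H"
    and S: "S \<subseteq> carrier G" and inv: "H <#> S = S"
  shows "card S = card {C \<in> rcosets H. C \<subseteq> S} * card H"
proof -
  let ?P = "{C \<in> rcosets H. C \<subseteq> S}"
  have "x \<in> \<Union>?P" if x: "x \<in> S" for x
  proof -
    have "H #> x \<subseteq> S"
      using x inv unfolding set_mult_def r_coset_def by blast
    moreover have "H #> x \<in> rcosets H" "x \<in> H #> x"
      using x S H by (auto simp: RCOSETS_def intro: rcos_self)
    ultimately show ?thesis by blast
  qed
  then have U: "\<Union>?P = S" by blast
  have c: "card C = card H" "finite C" if "C \<in> ?P" for C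
    using that card_rcosets_equal rcosets_finite fin H subgroup.subset by fastforce+
  have d: "pairwise disjnt ?P"
    using rcos_disjoint[OF H] by (rule pairwise_subset) blast
  have "card (\<Union>?P) = (\<Sum>C\<in>?P. card C)"
    using card_Union_disjoint[OF d] c by blast
  also have "\<dots> = card ?P * card H"
    using c by simp
  finally show ?thesis using U by simp
qed


section \<open>\<open>C\<^sup>+\<close>-groups\<close>

text \<open>A pair \<open>(G, R)\<close> of rank \<open>r\<close> is given by \<open>\<alpha>\<close>, with \<open>R = \<alpha> ` {1..<r}\<close>; the value \<open>\<alpha> 0\<close> is
  never used, \<open>alpha_ext\<close> puts the identity there.\<close>

definition alpha_ext :: "('a, 'b) monoid_scheme \<Rightarrow> (nat \<Rightarrow> 'a) \<Rightarrow> nat \<Rightarrow> 'a" where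
  "alpha_ext G \<alpha> = \<alpha>(0 := \<one>\<^bsub>G\<^esub>)"

definition alpha2 :: "('a, 'b) monoid_scheme \<Rightarrow> (nat \<Rightarrow> 'a) \<Rightarrow> nat \<Rightarrow> nat \<Rightarrow> 'a" where
  "alpha2 G \<alpha> i j = inv\<^bsub>G\<^esub> (alpha_ext G \<alpha> i) \<otimes>\<^bsub>G\<^esub> alpha_ext G \<alpha> j"

definition H_sub :: "('a, 'b) monoid_scheme \<Rightarrow> (nat \<Rightarrow> 'a) \<Rightarrow> nat set \<Rightarrow> 'a set" where
  "H_sub G \<alpha> J = generate G {alpha2 G \<alpha> i j | i j. i \<in> J \<and> j \<in> J}"

definition Cplus_group :: "('a, 'b) monoid_scheme \<Rightarrow> nat \<Rightarrow> (nat \<Rightarrow> 'a) \<Rightarrow> bool" where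
  "Cplus_group G r \<alpha> \<longleftrightarrow>
     group G \<and>
     \<alpha> ` {1..<r} \<subseteq> carrier G \<and>
     generate G (\<alpha> ` {1..<r}) = carrier G \<and>
     (\<forall>J K. J \<subseteq> {0..<r} \<and> K \<subseteq> {0..<r} \<and> card J \<ge> 2 \<and> card K \<ge> 2 \<longrightarrow>
        H_sub G \<alpha> J \<inter> H_sub G \<alpha> K = H_sub G \<alpha> (J \<inter> K))"

definition Gplus_sub :: "('a, 'b) monoid_scheme \<Rightarrow> nat \<Rightarrow> (nat \<Rightarrow> 'a) \<Rightarrow> nat \<Rightarrow> 'a set" where
  "Gplus_sub G r \<alpha> i =
     (if i = 0 then generate G {inv\<^bsub>G\<^esub> (\<alpha> 1) \<otimes>\<^bsub>G\<^esub> \<alpha> j | j. 2 \<le> j \<and> j \<le> r - 1}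
      else generate G {\<alpha> j | j. 1 \<le> j \<and> j \<le> r - 1 \<and> j \<noteq> i})"

end

(* Let C0 = {G_k} be the base chamber.  For i, j distinct, alpha_ij = alpha_ik alpha_kj with k different
   from both shows that the coset G_j alpha_ij meets G_i; hence C0 has, for every k, a k-neighbour
   through G_k alpha_ik, and thinness says that there is no other one.  So C0 and its 0-neighbour D0
   represent the only two G-orbits of chambers.

   If the geometry is thin and residually connected, a walk in the residue of the base flag of type J
   shows that H_(I - J) is transitive on the elements of each type in that residue, by downward
   induction on J, and (i) follows.  Conversely, (i) and (iii) give thinness for all types, and
   H_(I - J) being generated by the alpha_ij gives walks in the residues.

   Finally, an automorphism of the geometry taking C0 to D0 conjugates each alpha_j to its inverse, and
   a group automorphism inverting all alpha_j induces such an automorphism of the geometry; this is the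
   equivalence of (iv) with chirality.  Condition (ii) holds in every C+-group. *)

theory Submission
  imports Defs
begin

section \<open>The group of type-preserving automorphisms\<close>

text \<open>The formulas come from the regular case. If reflections \<rho>_0, ..., \<rho>_(r-1)
  exchanged the base chamber with its neighbours, one could take \<alpha>_j = \<rho>_0 \<rho>_j;
  then \<open>a i j\<close> would be \<rho>_i \<rho>_j, and conjugation by \<rho>_0 would invert
  every \<alpha>_j. Reflections need not exist here, but their traces on chambers do: left
  multiplication of a representative by \<open>a i k\<close> passes to the k-neighbour, right
  multiplication is the group action, and the two commute. So whatever holds at the base chamber
  holds at its translates. Chirality asks whether an automorphism of the geometry does the work of
  \<rho>_0; that such an automorphism normalises G is not given but results from thinness, since
  neighbours must go to neighbours.

  The trivial group is a degenerate case: it is a C+-group with a single chamber, and the two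
  candidates for an element of a rank one residue coincide. Hence nontriviality is carried along as
  a hypothesis, and has to be drawn from thinness in one direction and from (iii) in the
  other.\<close>

lemma mem_AutI:
  "\<alpha> \<in> carrier (AutI \<Gamma>) \<longleftrightarrow> \<alpha> \<in> Bij (elems \<Gamma>) \<and>
     (\<forall>x\<in>elems \<Gamma>. type_of \<Gamma> (\<alpha> x) = type_of \<Gamma> x) \<and>
     (\<forall>x\<in>elems \<Gamma>. \<forall>y\<in>elems \<Gamma>. (x, y) \<in> incidence \<Gamma> \<longleftrightarrow> (\<alpha> x, \<alpha> y) \<in> incidence \<Gamma>)"
  by (simp add: AutI_def)

lemma AutI_inv_into:
  assumes "\<alpha> \<in> carrier (AutI \<Gamma>)"
  shows "restrict (inv_into (elems \<Gamma>) \<alpha>) (elems \<Gamma>) \<in> carrier (AutI \<Gamma>)"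
proof -
  let ?X = "elems \<Gamma>" and ?\<beta> = "restrict (inv_into (elems \<Gamma>) \<alpha>) (elems \<Gamma>)"
  have B: "\<alpha> \<in> Bij ?X" using assms by (simp add: mem_AutI)
  have \<beta>: "?\<beta> x \<in> ?X" "\<alpha> (?\<beta> x) = x" if "x \<in> ?X" for x
    using B that by (auto simp: Bij_def bij_betw_def inv_into_into f_inv_into_f)
  have "type_of \<Gamma> (?\<beta> x) = type_of \<Gamma> x" if "x \<in> ?X" for x
    using assms \<beta>[OF that] unfolding mem_AutI by metis
  moreover have "(x, y) \<in> incidence \<Gamma> \<longleftrightarrow> (?\<beta> x, ?\<beta> y) \<in> incidence \<Gamma>" if "x \<in> ?X" "y \<in> ?X" for x y
    using assms \<beta>[OF that(1)] \<beta>[OF that(2)] unfolding mem_AutI by metis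
  ultimately show ?thesis using restrict_inv_into_Bij[OF B] by (simp add: mem_AutI)
qed

lemma group_AutI: "group (AutI \<Gamma>)"
proof -
  let ?B = "BijGroup (elems \<Gamma>)" and ?A = "carrier (AutI \<Gamma>)"
  interpret B: group ?B by (rule group_BijGroup)
  have B: "\<alpha> \<in> Bij (elems \<Gamma>)" if "\<alpha> \<in> ?A" for \<alpha> using that by (simp add: mem_AutI)
  have "subgroup ?A ?B"
  proof (rule B.subgroupI)
    show "?A \<subseteq> carrier ?B" using B by (auto simp: BijGroup_def)
    have "(\<lambda>x\<in>elems \<Gamma>. x) \<in> ?A" by (simp add: mem_AutI id_Bij)
    then show "?A \<noteq> {}" by blast
    show "inv\<^bsub>?B\<^esub> \<alpha> \<in> ?A" if "\<alpha> \<in> ?A" for \<alpha>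
      using AutI_inv_into[OF that] by (simp add: inv_BijGroup B that)
    show "\<alpha> \<otimes>\<^bsub>?B\<^esub> \<beta> \<in> ?A" if "\<alpha> \<in> ?A" "\<beta> \<in> ?A" for \<alpha> \<beta>
    proof -
      have "\<beta> x \<in> elems \<Gamma>" if "x \<in> elems \<Gamma>" for x
        using Bij_imp_funcset[OF B[OF \<open>\<beta> \<in> ?A\<close>]] that by blast
      then show ?thesis
        using that by (simp add: BijGroup_def B compose_Bij mem_AutI) (simp add: compose_def)
    qed
  qed
  then have "group (?B\<lparr>carrier := ?A\<rparr>)" by (rule subgroup.subgroup_is_group) (rule group_BijGroup)
  then show ?thesis by (simp add: AutI_def)
qed

lemma AutI_image_chamber:
  assumes \<alpha>: "\<alpha> \<in> carrier (AutI \<Gamma>)" and C: "C \<in> chambers \<Gamma>"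
  shows "\<alpha> ` C \<in> chambers \<Gamma>"
proof -
  have X: "C \<subseteq> elems \<Gamma>" using C by (simp add: chambers_def flag_def)
  have "\<alpha> ` elems \<Gamma> \<subseteq> elems \<Gamma>" using \<alpha> Bij_imp_funcset by (fastforce simp: mem_AutI)
  moreover have "type_of \<Gamma> ` \<alpha> ` C = type_of \<Gamma> ` C"
    unfolding image_image using \<alpha> X by (intro image_cong) (auto simp: mem_AutI)
  moreover have "(\<alpha> x, \<alpha> y) \<in> incidence \<Gamma>" if "x \<in> C" "y \<in> C" for x y
  proof -
    have "(x, y) \<in> incidence \<Gamma>" using C that by (simp add: chambers_def flag_def)
    then show ?thesis using \<alpha> X that unfolding mem_AutI by blast
  qed
  moreover have "\<alpha> ` C \<subseteq> elems \<Gamma>" using X calculation(1) by blast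
  ultimately show ?thesis using C unfolding chambers_def flag_def by auto
qed

text \<open>\<open>orbit\<close> makes sense for any family of maps; that orbits are the classes of
  an equivalence relation on the chambers is available only for an action by permutations.\<close>

lemma chamber_action_group_action:
  "group_action (AutI \<Gamma>) (chambers \<Gamma>) (chamber_action \<Gamma>)"
proof -
  let ?A = "carrier (AutI \<Gamma>)" and ?c = "chamber_action \<Gamma>" and ?E = "chambers \<Gamma>"
  have X: "C \<subseteq> elems \<Gamma>" if "C \<in> ?E" for C using that by (simp add: chambers_def flag_def)
  have B: "?c \<alpha> \<in> Bij ?E" if \<alpha>: "\<alpha> \<in> ?A" for \<alpha>
  proof -
    define \<beta> where "\<beta> = restrict (inv_into (elems \<Gamma>) \<alpha>) (elems \<Gamma>)"
    have bij: "bij_betw \<alpha> (elems \<Gamma>) (elems \<Gamma>)" using \<alpha> by (simp add: mem_AutI Bij_def)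
    have "bij_betw (\<lambda>C. \<alpha> ` C) ?E ?E"
    proof (rule bij_betw_byWitness[where f' = "\<lambda>C. \<beta> ` C"])
      show "\<forall>C\<in>?E. \<beta> ` \<alpha> ` C = C"
      proof
        fix C assume "C \<in> ?E"
        then have "\<beta> (\<alpha> x) = x" if "x \<in> C" for x
          using that X bij unfolding \<beta>_def
            by (metis bij_betw_apply bij_betw_inv_into_left restrict_apply' subsetD)
        then show "\<beta> ` \<alpha> ` C = C" by (simp add: image_image)
      qed
      show "\<forall>C\<in>?E. \<alpha> ` \<beta> ` C = C"
      proof
        fix C assume "C \<in> ?E"
        then have "\<alpha> (\<beta> x) = x" if "x \<in> C" for x
          using that X bij unfolding \<beta>_def
            by (metis bij_betw_inv_into_right restrict_apply' subsetD)
        then show "\<alpha> ` \<beta> ` C = C" by (simp add: image_image)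
      qed
    qed (use AutI_image_chamber[OF \<alpha>] AutI_image_chamber[OF AutI_inv_into[OF \<alpha>]] in
        \<open>auto simp: \<beta>_def\<close>)
    then have "bij_betw (?c \<alpha>) ?E ?E"
      by (rule bij_betw_cong[THEN iffD1, rotated]) (simp add: chamber_action_def)
    then show ?thesis by (simp add: Bij_def chamber_action_def)
  qed
  have "?c (\<alpha> \<otimes>\<^bsub>AutI \<Gamma>\<^esub> \<beta>) = ?c \<alpha> \<otimes>\<^bsub>BijGroup ?E\<^esub> ?c \<beta>" if "\<alpha> \<in> ?A" "\<beta> \<in> ?A" for \<alpha> \<beta>
  proof -
    have "\<alpha> \<otimes>\<^bsub>AutI \<Gamma>\<^esub> \<beta> = compose (elems \<Gamma>) \<alpha> \<beta>"
      using that by (simp add: AutI_def BijGroup_def)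
    moreover have "compose (elems \<Gamma>) \<alpha> \<beta> ` C = \<alpha> ` \<beta> ` C" if "C \<in> ?E" for C
      using X[OF that] by (force simp: compose_def)
    ultimately have "?c (\<alpha> \<otimes>\<^bsub>AutI \<Gamma>\<^esub> \<beta>) = compose ?E (?c \<alpha>) (?c \<beta>)"
      using that
      by (intro ext) (simp add: chamber_action_def compose_def[of "chambers \<Gamma>"] AutI_image_chamber)
    then show ?thesis using that B by (simp add: BijGroup_def)
  qed
  then have "?c \<in> hom (AutI \<Gamma>) (BijGroup ?E)"
    using B by (auto simp: hom_def BijGroup_def)
  then show ?thesis
    by (simp add: group_action_def group_hom_def group_hom_axioms_def group_AutI group_BijGroup)
qed

lemma chamber_orbit_eq:
  assumes "\<alpha> \<in> carrier (AutI \<Gamma>)" "C \<in> chambers \<Gamma>" "D = \<alpha> ` C"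
  shows "orbit (AutI \<Gamma>) (chamber_action \<Gamma>) D = orbit (AutI \<Gamma>) (chamber_action \<Gamma>) C"
proof -
  interpret group_action "AutI \<Gamma>" "chambers \<Gamma>" "chamber_action \<Gamma>"
    by (rule chamber_action_group_action)
  have D: "D \<in> chambers \<Gamma>" using assms by (simp add: AutI_image_chamber)
  have "D \<in> orbit (AutI \<Gamma>) (chamber_action \<Gamma>) C"
    using assms by (auto simp: orbit_def chamber_action_def)
  moreover have "E \<in> chambers \<Gamma>" if "E \<in> orbit (AutI \<Gamma>) (chamber_action \<Gamma>) C'" "C' \<in> chambers \<Gamma>" for E C'
    using that element_image by (auto simp: orbit_def)
  ultimately show ?thesis
    using assms(2) D orbit_sym orbit_trans by (intro equalityI subsetI) meson+
qed

section \<open>\<open>C\<^sup>+\<close>-groups and their maximal parabolic subgroups\<close>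

locale cplus = group G for G (structure) +
  fixes r :: nat and \<alpha> :: "nat \<Rightarrow> 'a"
  assumes r3: "3 \<le> r" and cplus: "Cplus_group G r \<alpha>"
begin

abbreviation I :: "nat set" where "I \<equiv> {0..<r}"
abbreviation a :: "nat \<Rightarrow> nat \<Rightarrow> 'a" where "a \<equiv> alpha2 G \<alpha>"
abbreviation H :: "nat set \<Rightarrow> 'a set" where "H \<equiv> H_sub G \<alpha>"
abbreviation Gp :: "nat \<Rightarrow> 'a set" where "Gp \<equiv> Gplus_sub G r \<alpha>"
abbreviation \<Gamma> :: "(nat \<times> 'a set, nat) incidence_system" where "\<Gamma> \<equiv> coset_system G I Gp"

lemma ext_closed: "k < r \<Longrightarrow> alpha_ext G \<alpha> k \<in> carrier G"
  using cplus by (cases "k = 0") (auto simp: alpha_ext_def Cplus_group_def)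

lemma a_closed [simp]: "i < r \<Longrightarrow> j < r \<Longrightarrow> a i j \<in> carrier G"
  by (simp add: alpha2_def ext_closed)

lemma a_mult: "i < r \<Longrightarrow> j < r \<Longrightarrow> k < r \<Longrightarrow> a i j \<otimes> a j k = a i k"
  by (simp add: alpha2_def ext_closed m_assoc inv_solve_left')
     (simp add: ext_closed m_assoc[symmetric])

lemma a_mult_assoc:
  "i < r \<Longrightarrow> j < r \<Longrightarrow> k < r \<Longrightarrow> g \<in> carrier G \<Longrightarrow> a i j \<otimes> (a j k \<otimes> g) = a i k \<otimes> g"
  by (simp add: a_mult m_assoc[symmetric])

lemma a_self [simp]: "i < r \<Longrightarrow> a i i = \<one>"
  by (simp add: alpha2_def ext_closed)

lemma a_inv: "i < r \<Longrightarrow> j < r \<Longrightarrow> inv (a i j) = a j i"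
  by (simp add: alpha2_def ext_closed inv_mult_group)

lemma a_zero: "0 < j \<Longrightarrow> j < r \<Longrightarrow> a 0 j = \<alpha> j"
  using ext_closed[of j] by (simp add: alpha2_def alpha_ext_def)

lemma H_subgroup: "J \<subseteq> I \<Longrightarrow> subgroup (H J) G"
  unfolding H_sub_def by (intro generate_is_subgroup) (auto intro!: a_closed)

lemma H_mono: "J \<subseteq> K \<Longrightarrow> H J \<subseteq> H K"
  unfolding H_sub_def by (intro mono_generate) blast

lemma a_in_H: "i \<in> J \<Longrightarrow> j \<in> J \<Longrightarrow> a i j \<in> H J"
  unfolding H_sub_def by (intro generate.incl) blast

text \<open>The inverse of \<open>a i j\<close> is \<open>a j i\<close>, so the generating set is
  closed under inverses and the induction has no case for them.\<close>

lemma H_induct [consumes 2, case_names one gen mult]: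
  assumes "x \<in> H J" "J \<subseteq> I" "P \<one>" "\<And>i j. i \<in> J \<Longrightarrow> j \<in> J \<Longrightarrow> P (a i j)"
    and "\<And>x y. x \<in> H J \<Longrightarrow> y \<in> H J \<Longrightarrow> P x \<Longrightarrow> P y \<Longrightarrow> P (x \<otimes> y)"
  shows "P x"
  using assms(1) unfolding H_sub_def
proof (induction rule: generate.induct)
  case (inv h)
  then obtain i j where "h = a i j" "i \<in> J" "j \<in> J" by blast
  then show ?case using assms(2,4) by (auto simp: a_inv subset_eq)
next
  case (eng x y)
  then show ?case using assms(5) by (simp add: H_sub_def)
qed (use assms(3,4) in auto)

lemma H_subset_subgroup:
  assumes "subgroup S G" "\<And>i j. i \<in> J \<Longrightarrow> j \<in> J \<Longrightarrow> a i j \<in> S"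
  shows "H J \<subseteq> S"
  unfolding H_sub_def using assms by (intro generate_subgroup_incl) auto

lemma H_single: "k < r \<Longrightarrow> H {k} = {\<one>}"
  using H_subset_subgroup[OF triv_subgroup, of "{k}"] subgroup.one_closed[OF H_subgroup[of "{k}"]]
  by auto

lemma H_Int: "J \<subseteq> I \<Longrightarrow> K \<subseteq> I \<Longrightarrow> 2 \<le> card J \<Longrightarrow> 2 \<le> card K \<Longrightarrow> H J \<inter> H K = H (J \<inter> K)"
  using cplus by (simp add: Cplus_group_def)

lemma H_I: "H I = carrier G"
proof
  show "H I \<subseteq> carrier G" by (rule subgroup.subset[OF H_subgroup]) simp
  have "generate G (\<alpha> ` {1..<r}) \<subseteq> H I"
  proof (rule generate_subgroup_incl[OF _ H_subgroup])
    show "\<alpha> ` {1..<r} \<subseteq> H I"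
    proof
      fix x assume "x \<in> \<alpha> ` {1..<r}"
      then obtain j where "x = \<alpha> j" "1 \<le> j" "j < r" by auto
      then show "x \<in> H I" using a_in_H[of 0 I j] by (simp add: a_zero)
    qed
  qed simp
  then show "carrier G \<subseteq> H I" using cplus by (simp add: Cplus_group_def)
qed

text \<open>The definition of \<open>Gp\<close> uses only the generators \<open>a b j\<close> with a
  fixed base point b different from k, namely 1 for k = 0 and 0 otherwise. All other
  \<open>a i j\<close> avoiding k arise as the quotient of \<open>a b i\<close> and
  \<open>a b j\<close>.\<close>

lemma Gp_eq:
  assumes "k < r"
  shows "Gp k = H (I - {k})"
proof
  have sub: "subgroup (H (I - {k})) G" by (rule H_subgroup) auto
  show "Gp k \<subseteq> H (I - {k})"
  proof (cases "k = 0")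
    case True
    have "{inv (\<alpha> 1) \<otimes> \<alpha> j | j. 2 \<le> j \<and> j \<le> r - 1} \<subseteq> H (I - {0})"
    proof clarify
      fix j assume "2 \<le> j" "j \<le> r - 1"
      then show "inv (\<alpha> 1) \<otimes> \<alpha> j \<in> H (I - {0})"
        using a_in_H[of 1 "I - {0}" j] r3 by (simp add: alpha2_def alpha_ext_def)
    qed
    then show ?thesis using True sub by (simp add: Gplus_sub_def generate_subgroup_incl)
  next
    case False
    have "{\<alpha> j | j. 1 \<le> j \<and> j \<le> r - 1 \<and> j \<noteq> k} \<subseteq> H (I - {k})"
    proof clarify
      fix j assume "1 \<le> j" "j \<le> r - 1" "j \<noteq> k"
      then show "\<alpha> j \<in> H (I - {k})"
        using a_in_H[of 0 "I - {k}" j] a_zero[of j] r3 False by auto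
    qed
    then show ?thesis using False sub by (simp add: Gplus_sub_def generate_subgroup_incl)
  qed
  define b where "b = (if k = 0 then 1 else 0 :: nat)"
  have b: "b < r" "b \<noteq> k" using r3 by (auto simp: b_def)
  have incl: "a b j \<in> Gp k" if "j < r" "j \<noteq> k" for j
  proof (cases "j = b")
    case True
    then show ?thesis using b by (simp add: Gplus_sub_def generate.one)
  next
    case False
    show ?thesis
    proof (cases "k = 0")
      case True
      then have "a b j = inv (\<alpha> 1) \<otimes> \<alpha> j" "2 \<le> j" "j \<le> r - 1"
        using that False by (auto simp: b_def alpha2_def alpha_ext_def)
      then show ?thesis using True by (auto simp: Gplus_sub_def intro!: generate.incl)
    next
      case k: False
      then have "a b j = \<alpha> j" "1 \<le> j" "j \<le> r - 1"
        using that False a_zero[of j] by (auto simp: b_def)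
      then show ?thesis using k that by (auto simp: Gplus_sub_def intro!: generate.incl)
    qed
  qed
  have sG: "subgroup (Gp k) G"
  proof -
    have *: "\<alpha> j \<in> carrier G" if "1 \<le> j" "j < r" for j
      using that ext_closed[of j] by (simp add: alpha_ext_def)
    show ?thesis
      unfolding Gplus_sub_def using r3
      by (auto intro!: generate_is_subgroup m_closed *)
  qed
  show "H (I - {k}) \<subseteq> Gp k"
  proof (rule H_subset_subgroup[OF sG])
    fix i j assume ij: "i \<in> I - {k}" "j \<in> I - {k}"
    then have "inv (a b i) \<otimes> a b j \<in> Gp k"
      using incl sG by (simp add: subgroup.m_closed subgroup.m_inv_closed)
    then show "a i j \<in> Gp k" using ij b by (simp add: a_inv a_mult)
  qed
qed

lemma Gp_subgroup: "k < r \<Longrightarrow> subgroup (Gp k) G"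
  by (simp add: Gp_eq H_subgroup)

lemma H_subset_Gp: "k < r \<Longrightarrow> J \<subseteq> I \<Longrightarrow> k \<notin> J \<Longrightarrow> H J \<subseteq> Gp k"
  by (auto simp: Gp_eq intro!: H_mono)

text \<open>Types are added one at a time by the C+ condition. It applies because J stays proper:
  before a further type is added, its complement still has two elements.\<close>

lemma Inter_Gp:
  assumes "J \<subset> I" "x \<in> carrier G" "\<And>j. j \<in> J \<Longrightarrow> x \<in> Gp j"
  shows "x \<in> H (I - J)"
proof -
  have "finite J" using assms(1) finite_subset by blast
  then show ?thesis using assms
  proof (induction J)
    case empty
    then show ?case by (simp add: H_I)
  next
    case (insert j J)
    have "card (I - insert j J) > 0"
      using insert.prems(1) by (subst card_gt_0_iff) auto
    moreover have "card (I - insert j J) = card (I - J) - 1"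
      using insert.hyps insert.prems(1)
      by (metis DiffI card_Diff_singleton insert_subset Diff_insert psubset_imp_subset)
    ultimately have J: "2 \<le> card (I - J)" by linarith
    have "j < r" using insert.prems(1) by auto
    then have "2 \<le> card (I - {j})" using r3 by (simp add: card_Diff_singleton_if)
    moreover have "x \<in> H (I - J)" "x \<in> Gp j" using insert by auto
    ultimately have "x \<in> H ((I - J) \<inter> (I - {j}))"
      using J H_Int[of "I - J" "I - {j}"] Gp_eq[of j] insert.prems(1) by auto
    also have "(I - J) \<inter> (I - {j}) = I - insert j J" by auto
    finally show ?case .
  qed
qed

text \<open>This is the content of (ii), and also a rigidity statement: an element of G that fixes
  all elements of the base chamber except possibly one is the identity.\<close>

lemma Inter_Gp_trivial:
  assumes "k < r" "x \<in> carrier G" "\<And>j. j < r \<Longrightarrow> j \<noteq> k \<Longrightarrow> x \<in> Gp j"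
  shows "x = \<one>"
proof -
  have "x \<in> H (I - (I - {k}))" using assms by (intro Inter_Gp) auto
  also have "I - (I - {k}) = {k}" using assms(1) by auto
  finally show ?thesis using H_single assms(1) by simp
qed

subsection \<open>Incidence of cosets\<close>

definition el :: "nat \<Rightarrow> 'a \<Rightarrow> nat \<times> 'a set" where "el k g = (k, Gp k #> g)"

abbreviation inc :: "nat \<times> 'a set \<Rightarrow> nat \<times> 'a set \<Rightarrow> bool" where
  "inc x y \<equiv> (x, y) \<in> incidence \<Gamma>"

lemma fst_el [simp]: "fst (el k g) = k"
  by (simp add: el_def)

lemma el_eq_iff:
  assumes "k < r" "g \<in> carrier G" "h \<in> carrier G"
  shows "el k g = el k h \<longleftrightarrow> g \<otimes> inv h \<in> Gp k"
proof -
  interpret K: subgroup "Gp k" G using assms(1) by (rule Gp_subgroup)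
  have "el k g = el k h \<longleftrightarrow> g \<in> Gp k #> h"
    using repr_independence[of g "Gp k" h] repr_independenceD[of "Gp k" g h] assms
    by (auto simp: el_def Gp_subgroup)
  then show ?thesis using K.rcos_module[OF is_group assms(3,2)] by simp
qed

lemma el_mult:
  assumes "k < r" "g \<in> carrier G" "h \<in> carrier G" "x \<in> carrier G"
  shows "el k (g \<otimes> x) = el k (h \<otimes> x) \<longleftrightarrow> el k g = el k h"
proof -
  have "(g \<otimes> x) \<otimes> inv (h \<otimes> x) = g \<otimes> inv h"
    using assms(2-4) by (simp add: inv_mult_group m_assoc inv_solve_left')
       (simp add: m_assoc[symmetric])
  then show ?thesis using assms by (simp add: el_eq_iff)
qed

lemma el_absorb:
  assumes "k < r" "u \<in> Gp k" "g \<in> carrier G"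
  shows "el k (u \<otimes> g) = el k g"
proof -
  have "u \<in> carrier G" using assms(2) by (rule subgroup.mem_carrier[OF Gp_subgroup[OF assms(1)]])
  then show ?thesis using assms by (simp add: el_eq_iff m_assoc)
qed

lemma elems_iff: "x \<in> elems \<Gamma> \<longleftrightarrow> (\<exists>k<r. \<exists>g\<in>carrier G. x = el k g)"
  by (cases x) (auto simp: coset_system_def Let_def RCOSETS_def el_def)

lemma el_in_elems: "k < r \<Longrightarrow> g \<in> carrier G \<Longrightarrow> el k g \<in> elems \<Gamma>"
  by (auto simp: elems_iff)

lemma type_of_G [simp]: "type_of \<Gamma> = fst" and type_set_G [simp]: "type_set \<Gamma> = I"
  by (simp_all add: coset_system_def Let_def)

lemma inc_imp_elems: "inc x y \<Longrightarrow> x \<in> elems \<Gamma> \<and> y \<in> elems \<Gamma>"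
  by (simp add: coset_system_def Let_def)

text \<open>A point in the intersection of two cosets represents both. So flags of two elements
  always consist of cosets of one element; for larger flags this can fail, and
  \<open>trans_on\<close> below says when it does not.\<close>

lemma inc_iff:
  assumes "k < r" "l < r" "g \<in> carrier G" "h \<in> carrier G"
  shows "inc (el k g) (el l h) \<longleftrightarrow> (\<exists>x\<in>carrier G. el k g = el k x \<and> el l h = el l x)"
proof
  assume "inc (el k g) (el l h)"
  then obtain x where x: "x \<in> Gp k #> g" "x \<in> Gp l #> h"
    by (auto simp: coset_system_def Let_def el_def)
  then have "x \<in> carrier G"
    using assms Gp_subgroup by (meson is_group subgroup.elemrcos_carrier)
  moreover have "el k g = el k x" "el l h = el l x"
    using repr_independence[OF x(1)] repr_independence[OF x(2)] assms
    by (simp_all add: el_def Gp_subgroup)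
  ultimately show "\<exists>x\<in>carrier G. el k g = el k x \<and> el l h = el l x" by blast
next
  assume "\<exists>x\<in>carrier G. el k g = el k x \<and> el l h = el l x"
  then obtain x where x: "x \<in> carrier G" "el k g = el k x" "el l h = el l x" by blast
  moreover have "x \<in> Gp k #> x" "x \<in> Gp l #> x"
    using x(1) assms by (simp_all add: rcos_self Gp_subgroup)
  moreover have "el k x \<in> elems \<Gamma>" "el l x \<in> elems \<Gamma>"
    using x(1) assms by (simp_all add: el_in_elems)
  ultimately show "inc (el k g) (el l h)"
    by (auto simp: coset_system_def Let_def el_def)
qed

lemma inc_common: "k < r \<Longrightarrow> l < r \<Longrightarrow> g \<in> carrier G \<Longrightarrow> inc (el k g) (el l g)"
  by (auto simp: inc_iff)

lemma inc_sym: "inc x y \<Longrightarrow> inc y x"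
  by (auto simp: coset_system_def Let_def)

lemma inc_type:
  assumes "k < r" "g \<in> carrier G" "h \<in> carrier G" "inc (el k g) (el k h)"
  shows "el k g = el k h"
  using assms by (auto simp: inc_iff)

lemma inc_mult:
  assumes "k < r" "l < r" "g \<in> carrier G" "h \<in> carrier G" "x \<in> carrier G"
  shows "inc (el k (g \<otimes> x)) (el l (h \<otimes> x)) \<longleftrightarrow> inc (el k g) (el l h)"
proof -
  have *: "inc (el k (g \<otimes> x)) (el l (h \<otimes> x))"
    if gh: "inc (el k g) (el l h)" "g \<in> carrier G" "h \<in> carrier G" "x \<in> carrier G" for g h x
  proof -
    obtain y where "y \<in> carrier G" "el k g = el k y" "el l h = el l y"
      using gh assms by (auto simp: inc_iff)
    then show ?thesis
      using gh assms by (auto simp: inc_iff el_mult intro!: bexI[of _ "y \<otimes> x"])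
  qed
  show ?thesis
  proof
    assume "inc (el k (g \<otimes> x)) (el l (h \<otimes> x))"
    from *[OF this, of "inv x"] show "inc (el k g) (el l h)"
      using assms(3-5) by (simp add: m_assoc)
  qed (rule *[OF _ assms(3-5)])
qed

lemma a_in_Gp: "i < r \<Longrightarrow> j < r \<Longrightarrow> k < r \<Longrightarrow> i \<noteq> k \<Longrightarrow> j \<noteq> k \<Longrightarrow> a i j \<in> Gp k"
  using a_in_H[of i "I - {k}" j] by (simp add: Gp_eq)

lemma el_a_absorb:
  "i < r \<Longrightarrow> j < r \<Longrightarrow> k < r \<Longrightarrow> i \<noteq> k \<Longrightarrow> j \<noteq> k \<Longrightarrow> g \<in> carrier G \<Longrightarrow>
    el k (a i j \<otimes> g) = el k g"
  by (intro el_absorb a_in_Gp)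

lemma el_a_indep:
  assumes "i < r" "j < r" "k < r" "i \<noteq> k" "j \<noteq> k" "g \<in> carrier G"
  shows "el k (a i k \<otimes> g) = el k (a j k \<otimes> g)"
  using el_a_absorb[of i j k "a j k \<otimes> g"] assms by (simp add: a_mult_assoc)

lemma inc_a:
  assumes "i < r" "j < r" "i \<noteq> j" "g \<in> carrier G"
  shows "inc (el i g) (el j (a i j \<otimes> g))"
proof -
  obtain k where k: "k < r" "k \<noteq> i" "k \<noteq> j"
  proof
    let ?k = "if 0 \<notin> {i, j} then 0 else if 1 \<notin> {i, j} then 1 else 2 :: nat"
    show "?k < r" "?k \<noteq> i" "?k \<noteq> j" using r3 by auto
  qed
  \<comment> \<open>The common representative is \<open>a k j \<otimes> g\<close>:
    \<open>a k j\<close> avoids i, and \<open>a i j\<close> differs from \<open>a k j\<close> by the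
    left factor \<open>a i k\<close>, which avoids j. A third index k exists because the rank is at
    least three.\<close>
  then have "el i g = el i (a k j \<otimes> g)" "el j (a i j \<otimes> g) = el j (a k j \<otimes> g)"
    using assms el_a_indep[of i k j] by (simp_all add: el_a_absorb)
  then show ?thesis using assms k by (auto simp: inc_iff)
qed

text \<open>If i and j cannot be told apart, then for every further l the element
  \<open>a i l\<close> = \<open>a j l\<close> lies in both \<open>H {i, l}\<close> and
  \<open>H {j, l}\<close>, whose intersection \<open>H {l}\<close> is trivial.\<close>

lemma a_eq_one_trivial:
  assumes ij: "i < r" "j < r" "i \<noteq> j" and "a i j = \<one>"
  shows "carrier G = {\<one>}"
proof -
  have 1: "a i l = \<one>" if l: "l < r" "l \<noteq> i" "l \<noteq> j" for l
  proof -
    have "a i l = a j l"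
      using a_mult[of i j l] ij l assms(4) by simp
    then have "a i l \<in> H {i, l} \<inter> H {j, l}"
      using a_in_H[of i "{i, l}" l] a_in_H[of j "{j, l}" l] by simp
    also have "\<dots> = H ({i, l} \<inter> {j, l})"
      using ij l by (intro H_Int) auto
    also have "{i, l} \<inter> {j, l} = {l}" using ij l by auto
    finally show ?thesis using H_single l by simp
  qed
  have il: "a i l = \<one>" if "l < r" for l
    using 1 that assms by (cases "l = i \<or> l = j") auto
  have "a l m = \<one>" if "l < r" "m < r" for l m
    using a_mult[of i l m] il that ij by simp
  then have "H I \<subseteq> {\<one>}"
    by (intro H_subset_subgroup[OF triv_subgroup]) auto
  then show ?thesis by (auto simp: H_I)
qed

text \<open>Equality would put \<open>a i j\<close> into \<open>H {i, j}\<close> and into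
  \<open>H (I - {j})\<close>, hence into the trivial group \<open>H {i}\<close>.\<close>

lemma el_a_neq:
  assumes "carrier G \<noteq> {\<one>}" "i < r" "j < r" "i \<noteq> j" "g \<in> carrier G"
  shows "el j (a i j \<otimes> g) \<noteq> el j g"
proof
  assume "el j (a i j \<otimes> g) = el j g"
  then have "a i j \<in> Gp j" using assms el_mult[of j "a i j" \<one> g] by (simp add: el_eq_iff)
  then have "a i j \<in> H {i, j} \<inter> H (I - {j})"
    using assms a_in_H[of i "{i, j}" j] by (simp add: Gp_eq)
  also have "\<dots> = H ({i, j} \<inter> (I - {j}))"
    using assms r3 by (intro H_Int) (auto simp: card_Diff_singleton_if)
  also have "{i, j} \<inter> (I - {j}) = {i}" using assms by auto
  finally show False using H_single[of i] assms a_eq_one_trivial[of i j] by simp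
qed

text \<open>Any index different from \<open>k\<close> would do: by \<open>el_a_indep\<close> the coset of \<open>a i k\<close> modulo \<open>Gp k\<close>
  does not depend on \<open>i\<close>.\<close>

definition other :: "nat \<Rightarrow> nat" where "other k = (if k = 0 then 1 else 0)"

lemma other [simp]: "other k < r" "other k \<noteq> k"
  using r3 by (auto simp: other_def)

text \<open>Only the upper bound in thinness, at the base chamber. The two elements named always
  belong to the residue, but for the trivial group they coincide; thinness is this condition
  together with nontriviality.\<close>

definition base_thin :: "nat \<Rightarrow> bool" where
  "base_thin k \<longleftrightarrow> (\<forall>h\<in>carrier G. (\<forall>j<r. j \<noteq> k \<longrightarrow> inc (el k h) (el j \<one>)) \<longrightarrow>
     el k h = el k \<one> \<or> el k h = el k (a (other k) k))"

lemma base_thinD: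
  assumes "base_thin k" "k < r" "g \<in> carrier G" "h \<in> carrier G" "i < r" "i \<noteq> k"
    and inc: "\<And>j. j < r \<Longrightarrow> j \<noteq> k \<Longrightarrow> inc (el k h) (el j g)"
  shows "el k h = el k g \<or> el k h = el k (a i k \<otimes> g)"
proof -
  have 1: "el k (x \<otimes> inv g) = el k y \<longleftrightarrow> el k x = el k (y \<otimes> g)"
    if "x \<in> carrier G" "y \<in> carrier G" for x y
    using el_mult[of k "x \<otimes> inv g" y g] that assms by (simp add: m_assoc)
  have "inc (el k (h \<otimes> inv g)) (el j \<one>)" if "j < r" "j \<noteq> k" for j
    using inc_mult[of k j h g "inv g"] inc[OF that] that assms by simp
  then have "el k (h \<otimes> inv g) = el k \<one> \<or> el k (h \<otimes> inv g) = el k (a (other k) k)"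
    using assms unfolding base_thin_def by auto
  then show ?thesis
    using 1 el_a_indep[of i "other k" k g] assms by simp
qed

subsection \<open>Base flags, residues and thinness\<close>

definition base_flag :: "nat set \<Rightarrow> 'a \<Rightarrow> (nat \<times> 'a set) set" where "base_flag J g = (\<lambda>j. el j g) ` J"

lemma fst_base_flag [simp]: "fst ` base_flag J g = J"
  by (force simp: base_flag_def)

lemma flag_base: "J \<subseteq> I \<Longrightarrow> g \<in> carrier G \<Longrightarrow> flag \<Gamma> (base_flag J g)"
  unfolding flag_def base_flag_def by (auto intro!: el_in_elems inc_common)

lemma base_flag_eq_iff: "base_flag J g = base_flag J h \<longleftrightarrow> (\<forall>j\<in>J. el j g = el j h)"
proof
  assume eq: "base_flag J g = base_flag J h"
  show "\<forall>j\<in>J. el j g = el j h"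
  proof
    fix j assume "j \<in> J"
    then have "el j g \<in> base_flag J h" using eq by (auto simp: base_flag_def)
    then obtain i where "i \<in> J" "el j g = el i h" by (auto simp: base_flag_def)
    then show "el j g = el j h" by (metis fst_el)
  qed
qed (auto simp: base_flag_def)

lemma base_flag_eq_H: "J \<subseteq> I \<Longrightarrow> u \<in> H (I - J) \<Longrightarrow> g \<in> carrier G \<Longrightarrow> base_flag J (u \<otimes> g) = base_flag J g"
  unfolding base_flag_eq_iff by (intro ballI el_absorb subsetD[OF H_subset_Gp[of _ "I - J"]]) auto

lemma flag_types: "flag \<Gamma> F \<Longrightarrow> fst ` F \<subseteq> I"
  unfolding flag_def by (auto simp: elems_iff subset_eq)

lemma flag_subset: "flag \<Gamma> F \<Longrightarrow> E \<subseteq> F \<Longrightarrow> flag \<Gamma> E"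
  unfolding flag_def by blast

lemma flag_inj:
  assumes "flag \<Gamma> F" "x \<in> F" "y \<in> F" "fst x = fst y"
  shows "x = y"
proof -
  obtain k g where x: "k < r" "g \<in> carrier G" "x = el k g"
    using assms by (auto simp: flag_def elems_iff subset_eq)
  obtain l h where y: "l < r" "h \<in> carrier G" "y = el l h"
    using assms by (auto simp: flag_def elems_iff subset_eq)
  have "l = k" "inc x y" using assms x y by (auto simp: flag_def)
  then show ?thesis using inc_type x y by simp
qed

lemma flag_restrict: "flag \<Gamma> F \<Longrightarrow> E \<subseteq> F \<Longrightarrow> E = {x \<in> F. fst x \<in> fst ` E}"
  using flag_inj by blast

lemma flag_insert:
  assumes "flag \<Gamma> F" "x \<in> elems \<Gamma>" "\<And>y. y \<in> F \<Longrightarrow> inc x y"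
  shows "flag \<Gamma> (insert x F)"
proof -
  have "inc x x" using assms(2) by (auto simp: elems_iff inc_common)
  then show ?thesis using assms inc_sym unfolding flag_def by blast
qed

lemma right_mult_el: "k < r \<Longrightarrow> g \<in> carrier G \<Longrightarrow> h \<in> carrier G \<Longrightarrow> right_mult G g (el k h) = el k (h \<otimes> g)"
  by (simp add: right_mult_def el_def coset_mult_assoc subgroup.subset Gp_subgroup)

lemma right_mult_base_flag: "J \<subseteq> I \<Longrightarrow> g \<in> carrier G \<Longrightarrow> h \<in> carrier G \<Longrightarrow> right_mult G g ` base_flag J h = base_flag J (h \<otimes> g)"
  by (force simp: base_flag_def image_image right_mult_el subset_eq)

section \<open>Transitivity of G on the flags of a given type\<close>

definition trans_on :: "nat set \<Rightarrow> bool" where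
  "trans_on J \<longleftrightarrow> (\<forall>F. flag \<Gamma> F \<and> fst ` F = J \<longrightarrow> (\<exists>g\<in>carrier G. F = base_flag J g))"

lemma trans_onD: "trans_on J \<Longrightarrow> flag \<Gamma> F \<Longrightarrow> fst ` F = J \<Longrightarrow> \<exists>g\<in>carrier G. F = base_flag J g"
  by (simp add: trans_on_def)

lemma chambers_truncation:
  assumes "J \<subseteq> I"
  shows "chambers (truncation J \<Gamma>) = {F. flag \<Gamma> F \<and> fst ` F = J}"
proof -
  have "flag (truncation J \<Gamma>) F \<and> fst ` F = J \<longleftrightarrow> flag \<Gamma> F \<and> fst ` F = J" for F
    unfolding flag_def truncation_def Let_def by auto
  then show ?thesis by (auto simp: chambers_def truncation_def Let_def)
qed

lemma transitive_truncation_iff: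
  assumes J: "J \<subseteq> I"
  shows "transitive_on_chambers G (truncation J \<Gamma>) \<longleftrightarrow> trans_on J"
proof
  assume tr: "transitive_on_chambers G (truncation J \<Gamma>)"
  show "trans_on J" unfolding trans_on_def
  proof (intro allI impI)
    fix F assume "flag \<Gamma> F \<and> fst ` F = J"
    then have "F \<in> chambers (truncation J \<Gamma>)" "base_flag J \<one> \<in> chambers (truncation J \<Gamma>)"
      using J by (simp_all add: flag_base chambers_truncation)
    then obtain g where "g \<in> carrier G" "right_mult G g ` base_flag J \<one> = F"
      using tr unfolding transitive_on_chambers_def by blast
    then show "\<exists>g\<in>carrier G. F = base_flag J g" using J by (auto simp: right_mult_base_flag)
  qed
next
  assume tr: "trans_on J"
  show "transitive_on_chambers G (truncation J \<Gamma>)"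
    unfolding transitive_on_chambers_def chambers_truncation[OF J]
  proof (intro ballI)
    fix C D assume "C \<in> {F. flag \<Gamma> F \<and> fst ` F = J}" "D \<in> {F. flag \<Gamma> F \<and> fst ` F = J}"
    then have "\<exists>g\<in>carrier G. C = base_flag J g" "\<exists>h\<in>carrier G. D = base_flag J h"
      by (simp_all add: trans_onD[OF tr])
    then obtain g h where gh: "g \<in> carrier G" "h \<in> carrier G" "C = base_flag J g" "D = base_flag J h" by blast
    then have "right_mult G (inv g \<otimes> h) ` C = D"
      using J by (simp add: right_mult_base_flag m_assoc[symmetric])
    then show "\<exists>g\<in>carrier G. right_mult G g ` C = D" using gh by blast
  qed
qed

text \<open>Here the geometry property enters: a flag of type J is completed to a chamber, and the
  part of type K of that chamber is a translate of the base flag.\<close>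

lemma trans_on_subset:
  assumes geo: "geometry \<Gamma>" and tr: "trans_on K" and JK: "J \<subseteq> K" "K \<subseteq> I"
  shows "trans_on J"
  unfolding trans_on_def
proof (intro allI impI, elim conjE)
  fix F assume F: "flag \<Gamma> F" "fst ` F = J"
  then obtain C where C: "flag \<Gamma> C" "fst ` C = I" "F \<subseteq> C"
    using geo by (auto simp: geometry_def chambers_def)
  define E where "E = {x \<in> C. fst x \<in> K}"
  have "flag \<Gamma> E" using C(1) by (rule flag_subset) (auto simp: E_def)
  moreover have "fst ` E = K" using C(2) JK(2) by (force simp: E_def)
  ultimately obtain g where g: "g \<in> carrier G" "E = base_flag K g" using tr trans_onD by blast
  have "F = {x \<in> C. fst x \<in> J}" using flag_restrict[OF C(1,3)] F(2) by simp
  also have "\<dots> = {x \<in> E. fst x \<in> J}" using JK by (auto simp: E_def)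
  also have "\<dots> = base_flag J g" using JK by (auto simp: g base_flag_def)
  finally show "\<exists>g\<in>carrier G. F = base_flag J g" using g by blast
qed

section \<open>Residues of base flags, and thinness\<close>

lemma rank_residue: "rank (residue \<Gamma> F) = card (I - fst ` F)"
  by (simp add: rank_def residue_def Let_def)

lemma elems_residue_base_flag:
  assumes J: "J \<subseteq> I" and g: "g \<in> carrier G"
  shows "x \<in> elems (residue \<Gamma> (base_flag J g)) \<longleftrightarrow>
    (\<exists>k\<in>I - J. \<exists>h\<in>carrier G. x = el k h \<and> (\<forall>j\<in>J. inc (el k h) (el j g)))"
proof
  assume "x \<in> elems (residue \<Gamma> (base_flag J g))"
  then have x: "x \<in> elems \<Gamma>" "x \<notin> base_flag J g" "\<forall>j\<in>J. inc x (el j g)"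
    by (auto simp: residue_def Let_def base_flag_def)
  then obtain k h where k: "k < r" "h \<in> carrier G" "x = el k h" by (auto simp: elems_iff)
  have "k \<notin> J"
  proof
    assume "k \<in> J"
    then have "x = el k g" using x k g inc_type by simp
    then show False using x(2) \<open>k \<in> J\<close> by (simp add: base_flag_def)
  qed
  then show "\<exists>k\<in>I - J. \<exists>h\<in>carrier G. x = el k h \<and> (\<forall>j\<in>J. inc (el k h) (el j g))"
    using k x by auto
next
  assume "\<exists>k\<in>I - J. \<exists>h\<in>carrier G. x = el k h \<and> (\<forall>j\<in>J. inc (el k h) (el j g))"
  then obtain k h where k: "k < r" "k \<notin> J" "h \<in> carrier G" "x = el k h"
    and inc: "\<forall>j\<in>J. inc (el k h) (el j g)" by auto
  have "x \<notin> base_flag J g"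
  proof
    assume "x \<in> base_flag J g"
    then have "fst x \<in> fst ` base_flag J g" by (rule imageI)
    then show False using k by simp
  qed
  then show "x \<in> elems (residue \<Gamma> (base_flag J g))"
    using k inc by (auto simp: residue_def Let_def base_flag_def el_in_elems)
qed

lemma elems_residue_base_flag_corank1:
  assumes "k < r" "g \<in> carrier G"
  shows "x \<in> elems (residue \<Gamma> (base_flag (I - {k}) g)) \<longleftrightarrow>
    (\<exists>h\<in>carrier G. x = el k h \<and> (\<forall>j<r. j \<noteq> k \<longrightarrow> inc (el k h) (el j g)))"
proof -
  have "I - (I - {k}) = {k}" using assms(1) by auto
  moreover have "(\<forall>j\<in>I - {k}. P j) \<longleftrightarrow> (\<forall>j<r. j \<noteq> k \<longrightarrow> P j)" for P by auto
  ultimately show ?thesis using elems_residue_base_flag[of "I - {k}" g x] assms by simp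
qed

lemma base_thin_residue:
  assumes "base_thin k" "k < r" "g \<in> carrier G"
  shows "elems (residue \<Gamma> (base_flag (I - {k}) g)) = {el k g, el k (a (other k) k \<otimes> g)}"
    (is "?E = _")
proof
  show "?E \<subseteq> {el k g, el k (a (other k) k \<otimes> g)}"
  proof
    fix x assume "x \<in> ?E"
    then obtain h where "h \<in> carrier G" "x = el k h" "\<And>j. j < r \<Longrightarrow> j \<noteq> k \<Longrightarrow> inc (el k h) (el j g)"
      using assms(2,3) by (auto simp: elems_residue_base_flag_corank1)
    then show "x \<in> {el k g, el k (a (other k) k \<otimes> g)}"
      using base_thinD[OF assms, of h "other k"] by simp
  qed
  have "inc (el k (a (other k) k \<otimes> g)) (el j g)" if "j < r" "j \<noteq> k" for j
    using inc_a[of j k g] el_a_indep[of j "other k" k g] that assms by (auto intro: inc_sym)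
  then show "{el k g, el k (a (other k) k \<otimes> g)} \<subseteq> ?E"
    using assms(2,3) by (auto simp: elems_residue_base_flag_corank1 inc_common)
qed

lemma thinI:
  assumes nt: "carrier G \<noteq> {\<one>}" and bt: "\<And>k. k < r \<Longrightarrow> base_thin k"
    and tr: "\<And>k. k < r \<Longrightarrow> trans_on (I - {k})"
  shows "thin \<Gamma>"
  unfolding thin_def
proof (intro allI impI, elim conjE)
  fix F assume F: "flag \<Gamma> F" "rank (residue \<Gamma> F) = 1"
  then obtain k where "I - fst ` F = {k}" by (auto simp: rank_residue card_1_singleton_iff)
  then have k: "k < r" "fst ` F = I - {k}" using flag_types[OF F(1)] by auto
  then obtain g where g: "g \<in> carrier G" "F = base_flag (I - {k}) g" using tr F(1) trans_onD by blast
  then show "card (elems (residue \<Gamma> F)) = 2"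
    using k el_a_neq[OF nt, of "other k" k g] bt by (simp add: base_thin_residue)
qed

lemma card_residue_eq_2_iff:
  assumes k: "k < r"
  shows "card (elems (residue \<Gamma> (base_flag (I - {k}) \<one>))) = 2 \<longleftrightarrow> carrier G \<noteq> {\<one>} \<and> base_thin k"
    (is "card ?E = 2 \<longleftrightarrow> _")
proof
  assume "carrier G \<noteq> {\<one>} \<and> base_thin k"
  then show "card ?E = 2"
    using k el_a_neq[of "other k" k \<one>] by (simp add: base_thin_residue)
next
  assume card: "card ?E = 2"
  have nt: "carrier G \<noteq> {\<one>}"
  proof
    assume 1: "carrier G = {\<one>}"
    have "?E \<subseteq> {el k \<one>}" using k by (auto simp: elems_residue_base_flag_corank1 1)
    then have "card ?E \<le> 1" using card_mono[of "{el k \<one>}"] by simp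
    then show False using card by simp
  qed
  let ?D = "{el k \<one>, el k (a (other k) k)}"
  have "inc (el k (a (other k) k)) (el j \<one>)" if "j < r" "j \<noteq> k" for j
    using inc_a[of j k \<one>] el_a_indep[of j "other k" k \<one>] that k by (auto intro: inc_sym)
  then have "?D \<subseteq> ?E"
    using k by (auto simp: elems_residue_base_flag_corank1 inc_common)
  moreover have "card ?D = 2"
    using el_a_neq[OF nt, of "other k" k \<one>] k by simp
  moreover have "finite ?E" using card card.infinite by fastforce
  ultimately have "?D = ?E" using card by (simp add: card_subset_eq)
  moreover have "el k h \<in> ?E" if "h \<in> carrier G" "\<forall>j<r. j \<noteq> k \<longrightarrow> inc (el k h) (el j \<one>)" for h
    using that k by (auto simp: elems_residue_base_flag_corank1)
  ultimately show "carrier G \<noteq> {\<one>} \<and> base_thin k" using nt unfolding base_thin_def by blast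
qed

lemma thinD:
  assumes "thin \<Gamma>" "k < r"
  shows "carrier G \<noteq> {\<one>} \<and> base_thin k"
proof -
  have "I - (I - {k}) = {k}" using assms(2) by auto
  then show ?thesis
    using assms flag_base[of "I - {k}" \<one>] card_residue_eq_2_iff[of k]
    unfolding thin_def by (simp add: rank_residue)
qed

subsection \<open>Transitivity on flags\<close>

text \<open>x lies in \<open>Gp k <#> Gp j\<close> exactly when the coset of x modulo
  \<open>Gp k\<close> meets \<open>Gp j\<close>. So the intersection of these products is the union
  of the cosets that form the residue of the base flag of type \<open>I - {k}\<close>, and (iii)
  says that this residue has two elements.\<close>

lemma twice_as_large_iff:
  assumes k: "k < r"
  shows "twice_as_large G (\<Inter>j\<in>I - {k}. Gp k <#> Gp j) (Gp k) \<longleftrightarrow>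
    carrier G \<noteq> {\<one>} \<and> base_thin k"
proof -
  define S where "S = (\<Inter>j\<in>I - {k}. Gp k <#> Gp j)"
  let ?W = "{C \<in> rcosets (Gp k). C \<subseteq> S}"
  let ?E = "elems (residue \<Gamma> (base_flag (I - {k}) \<one>))"
  interpret K: subgroup "Gp k" G using k by (rule Gp_subgroup)
  have prod: "x \<in> Gp k <#> Gp j \<longleftrightarrow> inc (el k x) (el j \<one>)" if jx: "j < r" "x \<in> carrier G" for j x
  proof
    interpret J: subgroup "Gp j" G using \<open>j < r\<close> by (rule Gp_subgroup)
    assume "x \<in> Gp k <#> Gp j"
    then obtain u v where uv: "u \<in> Gp k" "v \<in> Gp j" "x = u \<otimes> v"
      unfolding set_mult_def by blast
    then have "el k x = el k v" "el j \<one> = el j v"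
      using k that(1) el_absorb[of j v \<one>] by (simp_all add: el_absorb)
    then show "inc (el k x) (el j \<one>)" using uv k that by (auto simp: inc_iff)
  next
    interpret J: subgroup "Gp j" G using \<open>j < r\<close> by (rule Gp_subgroup)
    assume "inc (el k x) (el j \<one>)"
    then obtain y where y: "y \<in> carrier G" "el k x = el k y" "el j \<one> = el j y"
      using k jx by (auto simp: inc_iff)
    then have "x \<otimes> inv y \<in> Gp k" "y \<in> Gp j"
      using k that el_eq_iff[of j \<one> y] by (auto simp: el_eq_iff dest: J.m_inv_closed)
    moreover have "x = x \<otimes> inv y \<otimes> y" using y that by (simp add: m_assoc)
    ultimately show "x \<in> Gp k <#> Gp j" unfolding set_mult_def by blast
  qed
  have sub: "S \<subseteq> carrier G"
  proof -
    have "S \<subseteq> Gp k <#> Gp (other k)" using other unfolding S_def by auto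
    also have "\<dots> \<subseteq> carrier G"
      using Gp_subgroup[of "other k"] by (intro set_mult_closed) (simp_all add: K.subset subgroup.subset)
    finally show ?thesis .
  qed
  have mem: "x \<in> S \<longleftrightarrow> (\<forall>j<r. j \<noteq> k \<longrightarrow> inc (el k x) (el j \<one>))" if "x \<in> carrier G" for x
    using prod that unfolding S_def by auto
  have inv: "u \<otimes> x \<in> S" if "u \<in> Gp k" "x \<in> S" for u x
  proof -
    have "x \<in> carrier G" using that(2) sub by blast
    then show ?thesis
      using mem[of x] mem[of "u \<otimes> x"] that k el_absorb[of k u x] by simp
  qed
  have coset: "Gp k #> x \<subseteq> S \<longleftrightarrow> x \<in> S" if "x \<in> carrier G" for x
    using inv rcos_self[OF that K.subgroup_axioms] unfolding r_coset_def by blast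
  have "Pair k ` ?W = ?E"
  proof (intro equalityI subsetI)
    fix x assume "x \<in> Pair k ` ?W"
    then obtain h where h: "h \<in> carrier G" "x = el k h" "Gp k #> h \<subseteq> S"
      by (auto simp: RCOSETS_def el_def)
    then show "x \<in> ?E" using k coset[of h] mem[of h] by (auto simp: elems_residue_base_flag_corank1)
  next
    fix x assume "x \<in> ?E"
    then obtain h where h: "h \<in> carrier G" "x = el k h" "\<forall>j<r. j \<noteq> k \<longrightarrow> inc (el k h) (el j \<one>)"
      using k by (auto simp: elems_residue_base_flag_corank1)
    then have "Gp k #> h \<in> ?W" using coset[of h] mem[of h] K.subset by (simp add: rcosetsI)
    then show "x \<in> Pair k ` ?W" using h by (simp add: el_def)
  qed
  moreover have "card (Pair k ` ?W) = card ?W" by (rule card_image) (auto intro: inj_onI)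
  ultimately have W: "card ?W = card ?E" by (simp only:)
  have "Gp k <#> S = S"
  proof
    show "Gp k <#> S \<subseteq> S" using inv unfolding set_mult_def by blast
    show "S \<subseteq> Gp k <#> S"
    proof
      fix x assume x: "x \<in> S"
      then have "x = \<one> \<otimes> x" using sub by auto
      then show "x \<in> Gp k <#> S" using x K.one_closed unfolding set_mult_def by blast
    qed
  qed
  then have "card S = card ?W * card (Gp k)" if "finite (Gp k)"
    using card_cosets_contained[OF K.subgroup_axioms that sub] by (simp only:)
  moreover have "card (Gp k) \<noteq> 0" if "finite (Gp k)"
    using that K.subset K.one_closed by (metis card_eq_0_iff empty_iff)
  \<comment> \<open>For finite \<open>Gp k\<close> the factor \<open>card (Gp k)\<close> is
    cancelled; for infinite \<open>Gp k\<close> the number of cosets is what the definition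
    counts.\<close>
  ultimately have "twice_as_large G S (Gp k) \<longleftrightarrow> card ?W = 2"
    unfolding twice_as_large_def by (cases "finite (Gp k)") simp_all
  then show ?thesis using card_residue_eq_2_iff[OF k] W by (simp only: S_def)
qed

section \<open>Transitivity from residual connectedness\<close>

lemma residue_edges:
  "(x, y) \<in> incidence_graph_edges (residue \<Gamma> F) \<longleftrightarrow>
     inc x y \<and> x \<noteq> y \<and> x \<in> elems (residue \<Gamma> F) \<and> y \<in> elems (residue \<Gamma> F)"
  by (auto simp: incidence_graph_edges_def residue_def Let_def)

lemma residue_H_transitive:
  assumes rc: "residually_connected \<Gamma>" and bt: "\<And>k. k < r \<Longrightarrow> base_thin k"
    and "J \<subseteq> I" "2 \<le> card (I - J)" "k \<in> I - J" "h \<in> carrier G"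
    and "\<And>j. j \<in> J \<Longrightarrow> inc (el k h) (el j \<one>)"
  shows "\<exists>u\<in>H (I - J). el k h = el k u"
  using assms(3-)
proof (induction "card (I - J)" arbitrary: J k h rule: less_induct)
  case less
  let ?R = "residue \<Gamma> (base_flag J \<one>)" and ?K = "I - J"
  interpret K: subgroup "H ?K" G by (rule H_subgroup) auto
  \<comment> \<open>One step of the walk, starting at \<open>el k \<one>\<close>. Its neighbours lie
    in the residue of the base flag of type \<open>insert k J\<close>, to which the induction
    hypothesis applies unless that residue has rank one. In rank one connectedness says nothing, and
    \<open>base_thin\<close> supplies the only two elements.\<close>
  have rest: "\<exists>w\<in>H ?K. el l h' = el l w"
    if kl: "k \<in> ?K" "l \<in> ?K" "l \<noteq> k" and h': "h' \<in> carrier G" "inc (el l h') (el k \<one>)"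
      "\<And>j. j \<in> J \<Longrightarrow> inc (el l h') (el j \<one>)" for k l h'
  proof (cases "card ?K = 2")
    case True
    then have "?K = {k, l}" using kl card_subset_eq[of ?K "{k, l}"] by simp
    then have "inc (el l h') (el j \<one>)" if "j < r" "j \<noteq> l" for j
      using h' that by (cases "j = k") auto
    then have "el l h' = el l \<one> \<or> el l h' = el l (a k l)"
      using base_thinD[OF bt, of l \<one> h' k] kl h' by simp
    then show ?thesis using K.one_closed a_in_H[OF kl(1,2)] by blast
  next
    case False
    have card: "card (I - insert k J) = card ?K - 1"
      using kl(1) by (metis Diff_insert card_Diff_singleton)
    have "\<exists>u\<in>H (I - insert k J). el l h' = el l u"
    proof (rule less.hyps)
      show "card (I - insert k J) < card ?K" "2 \<le> card (I - insert k J)"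
        using card False less.prems(2) by linarith+
    qed (use kl h' less.prems(1) in auto)
    then show ?thesis using H_mono[of "I - insert k J" ?K] by blast
  qed
  have res: "x \<in> elems ?R \<longleftrightarrow> (\<exists>k\<in>?K. \<exists>h\<in>carrier G. x = el k h \<and> (\<forall>j\<in>J. inc (el k h) (el j \<one>)))" for x
    using elems_residue_base_flag less.prems(1) by simp
  have "el k h \<in> elems ?R" "el k \<one> \<in> elems ?R"
    unfolding res using less.prems by (blast, auto intro!: bexI[of _ k] bexI[of _ \<one>] inc_common)
  moreover have "connected_incidence_graph ?R"
    using rc flag_base[OF less.prems(1)] less.prems(2)
    by (auto simp: residually_connected_def rank_residue)
  ultimately have "(el k \<one>, el k h) \<in> (incidence_graph_edges ?R)\<^sup>*"
    by (simp add: connected_incidence_graph_def)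
  \<comment> \<open>Every vertex reached has a representative in \<open>H ?K\<close>. To leave
    \<open>el m u\<close>, the edge is translated by \<open>inv u\<close>: this takes
    \<open>el m u\<close> to \<open>el m \<one>\<close> and fixes the base flag of type J, because u
    lies in \<open>Gp j\<close> for all j in J; so \<open>rest\<close> applies.\<close>
  then have "\<exists>l\<in>?K. \<exists>u\<in>H ?K. el k h = el l u"
  proof (induction rule: rtrancl_induct)
    case base
    then show ?case using less.prems(3) K.one_closed by blast
  next
    case (step x y)
    then obtain m u where m: "m \<in> ?K" "u \<in> H ?K" "x = el m u" by blast
    have e: "inc x y" "x \<noteq> y" "y \<in> elems ?R" using step.hyps(2) by (simp_all add: residue_edges)
    obtain l h' where l: "l \<in> ?K" "h' \<in> carrier G" "y = el l h'" "\<forall>j\<in>J. inc (el l h') (el j \<one>)"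
      using e(3) unfolding res by blast
    have u: "u \<in> carrier G" using m(2) by simp
    have "l \<noteq> m" using e m l u inc_type[of m u h'] by auto
    moreover have "inc (el l (h' \<otimes> inv u)) (el m \<one>)"
      using inc_mult[of l m h' u "inv u"] inc_sym[OF e(1)] l m u by simp
    moreover have "inc (el l (h' \<otimes> inv u)) (el j \<one>)" if "j \<in> J" for j
    proof -
      have "el j u = el j \<one>"
        using base_flag_eq_H[OF less.prems(1) m(2), of \<one>] that u by (simp add: base_flag_eq_iff)
      then show ?thesis
        using inc_mult[of l j h' u "inv u"] l u that less.prems(1) by auto
    qed
    ultimately obtain w where w: "w \<in> H ?K" "el l (h' \<otimes> inv u) = el l w"
      using rest[of m l "h' \<otimes> inv u"] m l u by auto
    then have "el l h' = el l (w \<otimes> u)"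
      using el_mult[of l "h' \<otimes> inv u" w u] l u by (simp add: m_assoc)
    then show ?case using l w m by blast
  qed
  then obtain l u where "l \<in> ?K" "u \<in> H ?K" "el k h = el l u" by blast
  moreover from this(3) have "l = k" by (metis fst_el)
  ultimately show ?case by blast
qed

text \<open>Once the part of type J has been matched with a translate of the base flag, the element
  of type k is adjusted by \<open>H (I - J)\<close>, which fixes the base flag of type J. The type
  has to stay proper: for nontrivial G, the base chamber and its 0-neighbour are not translates of
  each other.\<close>

lemma trans_onI:
  assumes rc: "residually_connected \<Gamma>" and bt: "\<And>k. k < r \<Longrightarrow> base_thin k" and "J \<subset> I"
  shows "trans_on J"
proof -
  have "finite J" using assms(3) finite_subset by blast
  then show ?thesis using \<open>J \<subset> I\<close>
  proof (induction J)
    case empty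
    have "base_flag {} \<one> = {}" by (simp add: base_flag_def)
    then show ?case by (auto simp: trans_on_def)
  next
    case (insert k J)
    show ?case unfolding trans_on_def
    proof (intro allI impI, elim conjE)
      fix F assume F: "flag \<Gamma> F" "fst ` F = insert k J"
      have JI: "J \<subset> I" "J \<subseteq> I" "k < r" "k \<notin> J" using insert by auto
      let ?F = "{x \<in> F. fst x \<in> J}"
      have "flag \<Gamma> ?F" using F(1) by (rule flag_subset) auto
      moreover have "fst ` ?F = J" using F(2) by force
      ultimately obtain g where g: "g \<in> carrier G" "?F = base_flag J g"
        using trans_onD[OF insert.IH[OF JI(1)]] by blast
      obtain x where x: "x \<in> F" "fst x = k" using F(2) by (metis image_iff insertI1)
      then have "x \<in> elems \<Gamma>" using F(1) by (auto simp: flag_def)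
      then obtain h where h: "h \<in> carrier G" "x = el k h" using x(2) by (auto simp: elems_iff)
      have "card (I - insert k J) > 0" using insert.prems by (subst card_gt_0_iff) auto
      moreover have "card (I - insert k J) = card (I - J) - 1"
        using JI by (metis Diff_insert card_Diff_singleton DiffI atLeastLessThan_iff le0)
      ultimately have card: "2 \<le> card (I - J)" by linarith
      have "inc (el k (h \<otimes> inv g)) (el j \<one>)" if "j \<in> J" for j
      proof -
        have "el j g \<in> ?F" using g that by (simp add: base_flag_def)
        then have "inc (el k h) (el j g)" using F(1) x h by (simp add: flag_def)
        then show ?thesis using inc_mult[of k j h g "inv g"] g h that JI by auto
      qed
      then obtain u where u: "u \<in> H (I - J)" "el k (h \<otimes> inv g) = el k u"
        using residue_H_transitive[OF rc bt JI(2) card, of k "h \<otimes> inv g"] JI g h by auto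
      have uc: "u \<in> carrier G" using u(1) H_subgroup[of "I - J"] by (auto dest: subgroup.mem_carrier)
      have "el k h = el k (u \<otimes> g)"
        using el_mult[of k "h \<otimes> inv g" u g] u g h uc JI by (simp add: m_assoc)
      moreover have "F = insert x ?F"
      proof
        show "F \<subseteq> insert x ?F"
        proof
          fix y assume y: "y \<in> F"
          show "y \<in> insert x ?F"
          proof (cases "fst y = k")
            case True
            then have "x = y" using flag_inj[OF F(1) x(1) y] x(2) by simp
            then show ?thesis by simp
          next
            case False
            then have "fst y \<in> J" using F(2) y by (metis imageI insertE)
            then show ?thesis using y by simp
          qed
        qed
      next
        show "insert x ?F \<subseteq> F" using x(1) by blast
      qed
      ultimately have "F = base_flag (insert k J) (u \<otimes> g)"
        using g h base_flag_eq_H[OF JI(2) u(1) g(1)] by (simp add: base_flag_def)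
      then show "\<exists>g\<in>carrier G. F = base_flag (insert k J) g" using uc g by blast
    qed
  qed
qed

subsection \<open>Chirality\<close>

text \<open>\<open>c k\<close> is \<one> for positive k and the inverse of \<open>\<alpha> 1\<close>
  for k = 0, so the cosets of the \<open>c k\<close> form the 0-neighbour of the base chamber. The
  uniform notation spares case distinctions on the type.\<close>

abbreviation c :: "nat \<Rightarrow> 'a" where "c k \<equiv> a (other k) 0"

lemma zero_less_r [simp]: "0 < r"
  using r3 by simp

lemma c_pos: "0 < k \<Longrightarrow> c k = \<one>"
  by (simp add: other_def)

lemma el_c:
  assumes "j < r" "k < r" "j \<noteq> k" "h \<in> carrier G"
  shows "el j (c j \<otimes> h) = el j (a k 0 \<otimes> h)"
proof (cases "j = 0")
  case True
  then show ?thesis using el_a_indep[of "other 0" k 0 h] assms by simp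
next
  case False
  then show ?thesis using assms by (simp add: c_pos el_a_absorb)
qed

lemma inc_c:
  assumes "k < r" "l < r" "h \<in> carrier G"
  shows "inc (el k (c k \<otimes> h)) (el l (c l \<otimes> h))"
proof (cases "k = l")
  case True
  then show ?thesis using assms by (simp add: inc_common)
next
  case False
  have "c k \<otimes> h = a (other k) k \<otimes> (a k 0 \<otimes> h)" using assms by (simp add: a_mult_assoc)
  also have "el k (a (other k) k \<otimes> (a k 0 \<otimes> h)) = el k (a l k \<otimes> (a k 0 \<otimes> h))"
    using assms False by (intro el_a_indep) simp_all
  finally show ?thesis
    using inc_a[of l k "a k 0 \<otimes> h"] el_c[of l k h] assms False by (auto intro: inc_sym)
qed

text \<open>The translate by \<open>h\<close> of the chamber that is adjacent to the base chamber in its element of type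
  \<open>0\<close>; by \<open>adj_chamber_insert\<close> it is, for every \<open>k\<close>, also adjacent in type \<open>k\<close> to a translate of the base
  chamber.\<close>

definition adj_chamber :: "'a \<Rightarrow> (nat \<times> 'a set) set" where "adj_chamber h = (\<lambda>k. el k (c k \<otimes> h)) ` I"

lemma fst_adj_chamber [simp]: "fst ` adj_chamber h = I"
  by (force simp: adj_chamber_def)

lemma flag_adj_chamber: "h \<in> carrier G \<Longrightarrow> flag \<Gamma> (adj_chamber h)"
  unfolding flag_def adj_chamber_def by (auto intro!: el_in_elems inc_c)

lemma base_flag_insert: "k < r \<Longrightarrow> base_flag I g = insert (el k g) (base_flag (I - {k}) g)"
  by (auto simp: base_flag_def)

lemma adj_chamber_insert:
  assumes "k < r" "h \<in> carrier G"
  shows "adj_chamber h = insert (el k (c k \<otimes> h)) (base_flag (I - {k}) (a k 0 \<otimes> h))"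
proof -
  have "adj_chamber h = insert (el k (c k \<otimes> h)) ((\<lambda>j. el j (c j \<otimes> h)) ` (I - {k}))"
    using assms(1) by (auto simp: adj_chamber_def)
  also have "(\<lambda>j. el j (c j \<otimes> h)) ` (I - {k}) = base_flag (I - {k}) (a k 0 \<otimes> h)"
    unfolding base_flag_def using assms el_c by (intro image_cong) auto
  finally show ?thesis .
qed

lemma chambers_G: "C \<in> chambers \<Gamma> \<longleftrightarrow> flag \<Gamma> C \<and> fst ` C = I"
  by (simp add: chambers_def)

lemma base_chamber: "g \<in> carrier G \<Longrightarrow> base_flag I g \<in> chambers \<Gamma>"
  by (simp add: chambers_G flag_base)

lemma adj_chamber_in_chambers: "g \<in> carrier G \<Longrightarrow> adj_chamber g \<in> chambers \<Gamma>"
  by (simp add: chambers_G flag_adj_chamber)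

lemma adjacent_base_flag_adj_chamber:
  assumes "carrier G \<noteq> {\<one>}"
  shows "adjacent (base_flag I \<one>) (adj_chamber \<one>)"
proof -
  let ?E = "base_flag (I - {0}) \<one>" and ?x = "el 0 \<one>" and ?y = "el 0 (c 0)"
  have eqs: "base_flag I \<one> = insert ?x ?E" "adj_chamber \<one> = insert ?y ?E"
    using base_flag_insert[of 0 \<one>] adj_chamber_insert[of 0 \<one>] by simp_all
  have "?x \<noteq> ?y" using el_a_neq[OF assms, of "other 0" 0 \<one>] by simp
  moreover have "z \<notin> ?E" if "fst z = 0" for z
  proof
    assume "z \<in> ?E"
    then have "fst z \<in> fst ` ?E" by (rule imageI)
    then show False using that by simp
  qed
  then have "?x \<notin> ?E" "?y \<notin> ?E" by simp_all
  ultimately have "base_flag I \<one> - adj_chamber \<one> = {?x}" "adj_chamber \<one> - base_flag I \<one> = {?y}" unfolding eqs by auto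
  then show ?thesis by (simp add: adjacent_def)
qed

section \<open>Inverting automorphisms of the group and automorphisms of the geometry\<close>

lemma not_chiral_if_inverting:
  assumes nt: "carrier G \<noteq> {\<one>}" and \<phi>: "\<phi> \<in> auto G"
    and gen: "\<And>j. 1 \<le> j \<Longrightarrow> j < r \<Longrightarrow> \<phi> (\<alpha> j) = inv (\<alpha> j)"
  shows "\<not> chiral \<Gamma>"
proof
  assume chiral: "chiral \<Gamma>"
  interpret \<phi>: group_hom G G \<phi>
    using \<phi> by (simp add: auto_def group_hom_def group_hom_axioms_def is_group)
  have \<phi>0: "\<phi> (a 0 j) = a j 0" if "j < r" for j
  proof (cases "j = 0")
    case False
    then show ?thesis using gen[of j] a_inv[of 0 j] that by (simp add: a_zero)
  qed simp
  have \<phi>0': "\<phi> (a j 0) = a 0 j" if "j < r" for j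
    using \<phi>.hom_inv[of "a 0 j"] \<phi>0[OF that] that by (simp add: a_inv)
  have \<phi>a: "\<phi> (a i j) = a 0 i \<otimes> a j 0" if "i < r" "j < r" for i j
    using \<phi>.hom_mult[of "a i 0" "a 0 j"] \<phi>0 \<phi>0' that by (simp add: a_mult)
  have \<phi>\<phi>: "\<phi> (\<phi> x) = x" if "x \<in> carrier G" for x
  proof -
    have "x \<in> H I" "I \<subseteq> I" using that by (simp_all add: H_I)
    then show ?thesis
    proof (induction rule: H_induct)
      case (gen i j)
      then show ?case by (simp add: \<phi>a \<phi>0 \<phi>0' a_mult)
    next
      case (mult x y)
      then show ?case by (simp add: H_I)
    qed simp_all
  qed
  \<comment> \<open>With b = \<open>other k\<close>, the generator \<open>a i j\<close> of
    \<open>Gp k\<close> goes to \<open>a b i \<otimes> a j b\<close>, and b, i, j all differ from k.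
    This makes \<open>\<beta>\<close> below independent of representatives.\<close>
  have \<psi>: "c k \<otimes> \<phi> u \<otimes> inv (c k) \<in> Gp k" if k: "k < r" and "u \<in> Gp k" for k u
  proof -
    interpret K: subgroup "Gp k" G using k by (rule Gp_subgroup)
    have "u \<in> H (I - {k})" "I - {k} \<subseteq> I" using that by (auto simp: Gp_eq)
    then show ?thesis
    proof (induction rule: H_induct)
      case (gen i j)
      then have "c k \<otimes> \<phi> (a i j) \<otimes> inv (c k) = a (other k) i \<otimes> a j (other k)"
        by (simp add: \<phi>a a_inv m_assoc a_mult a_mult_assoc)
      moreover have "a (other k) i \<in> Gp k" "a j (other k) \<in> Gp k"
        using gen k by (simp_all add: a_in_Gp)
      ultimately show ?case by simp
    next
      case (mult x y)
      then have xy: "x \<in> carrier G" "y \<in> carrier G"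
        using k K.mem_carrier by (simp_all add: Gp_eq)
      then have "c k \<otimes> \<phi> (x \<otimes> y) \<otimes> inv (c k) =
          (c k \<otimes> \<phi> x \<otimes> inv (c k)) \<otimes> (c k \<otimes> \<phi> y \<otimes> inv (c k))"
        by (simp add: m_assoc) (simp add: m_assoc[symmetric])
      then show ?case using mult by simp
    qed auto
  qed
  \<comment> \<open>The map \<open>\<phi>\<close> does not fix \<open>Gp 0\<close> but conjugates it by \<open>\<alpha> 1\<close>; the left factor \<open>c k\<close> corrects this.\<close>
  define \<beta> where "\<beta> = (\<lambda>x\<in>elems \<Gamma>. el (fst x) (c (fst x) \<otimes> \<phi> (SOME g. g \<in> carrier G \<and> x = el (fst x) g)))"
  have \<beta>: "\<beta> (el k g) = el k (c k \<otimes> \<phi> g)" if kg: "k < r" "g \<in> carrier G" for k g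
  proof -
    define h where "h = (SOME h. h \<in> carrier G \<and> el k g = el k h)"
    have h: "h \<in> carrier G" "el k g = el k h"
      using someI_ex[of "\<lambda>h. h \<in> carrier G \<and> el k g = el k h"] kg unfolding h_def by blast+
    have "h \<otimes> inv g \<in> Gp k" using h kg el_eq_iff[of k h g] by simp
    then have "c k \<otimes> \<phi> (h \<otimes> inv g) \<otimes> inv (c k) \<in> Gp k" by (rule \<psi>[OF kg(1)])
    moreover have "(c k \<otimes> \<phi> h) \<otimes> inv (c k \<otimes> \<phi> g) = c k \<otimes> \<phi> (h \<otimes> inv g) \<otimes> inv (c k)"
      using h kg by (simp add: inv_mult_group m_assoc)
    ultimately have "el k (c k \<otimes> \<phi> h) = el k (c k \<otimes> \<phi> g)"
      using h kg by (simp add: el_eq_iff)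
    then show ?thesis using kg el_in_elems by (simp add: \<beta>_def h_def)
  qed
  have closed: "\<beta> x \<in> elems \<Gamma>" and type: "fst (\<beta> x) = fst x" and invol: "\<beta> (\<beta> x) = x"
    if "x \<in> elems \<Gamma>" for x
  proof -
    obtain k g where kg: "k < r" "g \<in> carrier G" "x = el k g" using \<open>x \<in> elems \<Gamma>\<close> elems_iff by auto
    then show "\<beta> x \<in> elems \<Gamma>" "fst (\<beta> x) = fst x" by (simp_all add: \<beta> el_in_elems)
    \<comment> \<open>\<open>\<phi>\<close> inverts \<open>c k\<close>, so the two correcting
      factors cancel. As an involution, \<open>\<beta>\<close> is bijective, and preserving
      incidence in one direction is enough.\<close>
    have "c k \<otimes> \<phi> (c k \<otimes> \<phi> g) = c k \<otimes> (\<phi> (c k) \<otimes> g)" using kg by (simp add: \<phi>\<phi>)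
    also have "\<dots> = g" using kg by (simp add: \<phi>0' a_mult_assoc)
    finally show "\<beta> (\<beta> x) = x" using kg by (simp add: \<beta>)
  qed
  have inc: "inc (\<beta> x) (\<beta> y)" if "inc x y" for x y
  proof -
    obtain k g l h where x: "k < r" "g \<in> carrier G" "x = el k g" and y: "l < r" "h \<in> carrier G" "y = el l h"
      using inc_imp_elems[OF \<open>inc x y\<close>] elems_iff by metis
    then obtain z where z: "z \<in> carrier G" "x = el k z" "y = el l z"
      using \<open>inc x y\<close> by (auto simp: inc_iff)
    then show ?thesis using inc_c[of k l "\<phi> z"] x(1) y(1) by (simp add: \<beta>)
  qed
  have "bij_betw \<beta> (elems \<Gamma>) (elems \<Gamma>)"
    using closed invol by (intro bij_betw_byWitness[where f' = \<beta>]) auto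
  then have "\<beta> \<in> Bij (elems \<Gamma>)" by (simp add: Bij_def \<beta>_def)
  moreover have "inc x y \<longleftrightarrow> inc (\<beta> x) (\<beta> y)" if "x \<in> elems \<Gamma>" "y \<in> elems \<Gamma>" for x y
    using inc[of x y] inc[of "\<beta> x" "\<beta> y"] invol that by auto
  ultimately have A: "\<beta> \<in> carrier (AutI \<Gamma>)" using type by (simp add: mem_AutI)
  have "\<beta> ` base_flag I \<one> = adj_chamber \<one>"
    unfolding base_flag_def adj_chamber_def image_image by (intro image_cong) (simp_all add: \<beta>)
  then have "orbit (AutI \<Gamma>) (chamber_action \<Gamma>) (adj_chamber \<one>) =
      orbit (AutI \<Gamma>) (chamber_action \<Gamma>) (base_flag I \<one>)"
    by (intro chamber_orbit_eq[OF A]) (simp_all add: base_chamber)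
  then show False
    using chiral adjacent_base_flag_adj_chamber[OF nt] base_chamber[of \<one>] adj_chamber_in_chambers[of \<one>]
    unfolding chiral_def by auto
qed

text \<open>The wanted automorphism is conjugation by \<open>\<beta>\<close>. To see that it maps G
  to itself, chambers are followed through flips: \<open>base_flag I (a 0 j \<otimes> g)\<close>
  arises from \<open>base_flag I g\<close> by exchanging the element of type j and then that of type
  0, and the same two flips take \<open>adj_chamber h\<close> to
  \<open>adj_chamber (a j 0 \<otimes> h)\<close>.\<close>

lemma inverting_automorphism:
  assumes nt: "carrier G \<noteq> {\<one>}" and bt: "\<And>k. k < r \<Longrightarrow> base_thin k"
    and \<beta>: "\<beta> \<in> carrier (AutI \<Gamma>)" and \<beta>_base: "\<beta> ` base_flag I \<one> = adj_chamber \<one>"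
  shows "\<exists>\<phi>\<in>auto G. \<forall>x\<in>\<alpha> ` {1..<r}. \<phi> x = inv x"
proof -
  have bij: "bij_betw \<beta> (elems \<Gamma>) (elems \<Gamma>)" using \<beta> by (simp add: mem_AutI Bij_def)
  have inj: "\<beta> x = \<beta> y \<longleftrightarrow> x = y" if "x \<in> elems \<Gamma>" "y \<in> elems \<Gamma>" for x y
    using bij that by (auto simp: bij_betw_def dest: inj_onD)
  have inc: "inc (\<beta> x) (\<beta> y)" if "inc x y" for x y
    using \<beta> that inc_imp_elems[OF that] by (simp add: mem_AutI)
  have img: "\<exists>z\<in>carrier G. \<beta> (el k g) = el k z" if kg: "k < r" "g \<in> carrier G" for k g
  proof -
    have "el k g \<in> elems \<Gamma>" using kg by (rule el_in_elems)
    then have "\<beta> (el k g) \<in> elems \<Gamma>" "fst (\<beta> (el k g)) = k"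
      using bij \<beta> by (auto simp: mem_AutI dest: bij_betwE)
    then show ?thesis by (auto simp: elems_iff)
  qed
  \<comment> \<open>The image is incident with all elements of \<open>adj_chamber h\<close> of types
    other than k, and these form the translate of a base flag by \<open>a k 0 \<otimes> h\<close>;
    \<open>base_thin\<close> leaves two candidates.\<close>
  have dich: "\<beta> (el k x) = el k (a k 0 \<otimes> h) \<or> \<beta> (el k x) = el k (c k \<otimes> h)"
    if k: "k < r" and gh: "g \<in> carrier G" "h \<in> carrier G" and x: "x \<in> carrier G"
      and nb: "\<And>l. l < r \<Longrightarrow> l \<noteq> k \<Longrightarrow> \<beta> (el l g) = el l (c l \<otimes> h)"
      and adj: "\<And>l. l < r \<Longrightarrow> l \<noteq> k \<Longrightarrow> inc (el k x) (el l g)" for k g h x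
  proof -
    obtain z where z: "z \<in> carrier G" "\<beta> (el k x) = el k z" using img k x by blast
    have "inc (el k z) (el l (a k 0 \<otimes> h))" if "l < r" "l \<noteq> k" for l
      using inc[OF adj[OF that]] nb[OF that] el_c[of l k h] that k gh z by simp
    then have "el k z = el k (a k 0 \<otimes> h) \<or> el k z = el k (a (other k) k \<otimes> (a k 0 \<otimes> h))"
      using base_thinD[OF bt, of k "a k 0 \<otimes> h" z "other k"] k gh z by simp
    then show ?thesis using z k gh by (simp add: a_mult_assoc)
  qed
  \<comment> \<open>The two elements completing a flag of corank one go to the two elements
    completing its image. As \<open>\<beta>\<close> is injective, one image determines the
    other.\<close>
  have flip: "\<beta> (el k g) = el k (c k \<otimes> h) \<longleftrightarrow> \<beta> (el k (a i k \<otimes> g)) = el k (a k 0 \<otimes> h)"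
    if k: "k < r" and i: "i < r" "i \<noteq> k" and gh: "g \<in> carrier G" "h \<in> carrier G"
      and nb: "\<And>l. l < r \<Longrightarrow> l \<noteq> k \<Longrightarrow> \<beta> (el l g) = el l (c l \<otimes> h)" for k i g h
  proof -
    have adj: "inc (el k (a i k \<otimes> g)) (el l g)" if "l < r" "l \<noteq> k" for l
      using inc_a[of l k g] el_a_indep[of l i k g] that k i gh by (auto intro: inc_sym)
    have "\<beta> (el k g) \<noteq> \<beta> (el k (a i k \<otimes> g))"
      using el_a_neq[OF nt i(1) k i(2) gh(1)] k i gh by (simp add: inj el_in_elems)
    moreover have "el k (c k \<otimes> h) \<noteq> el k (a k 0 \<otimes> h)"
      using el_a_neq[OF nt, of "other k" k "a k 0 \<otimes> h"] k gh by (simp add: a_mult_assoc)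
    moreover have "\<beta> (el k g) = el k (a k 0 \<otimes> h) \<or> \<beta> (el k g) = el k (c k \<otimes> h)"
      using dich[OF k gh gh(1) nb] k gh by (simp add: inc_common)
    moreover have "\<beta> (el k (a i k \<otimes> g)) = el k (a k 0 \<otimes> h) \<or> \<beta> (el k (a i k \<otimes> g)) = el k (c k \<otimes> h)"
      using dich[OF k gh _ nb adj] k i gh by simp
    ultimately show ?thesis by auto
  qed
  \<comment> \<open>\<open>R g h\<close>: the chamber \<open>base_flag I g\<close> is mapped to \<open>adj_chamber h\<close>; \<open>Q x y\<close>: conjugation by \<open>\<beta>\<close> takes \<open>x\<close> to \<open>y\<close>.\<close>
  define R where "R g h \<longleftrightarrow> (\<forall>k<r. \<beta> (el k g) = el k (c k \<otimes> h))" for g h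
  define Q where "Q x y \<longleftrightarrow> x \<in> carrier G \<and> y \<in> carrier G \<and>
    (\<forall>g\<in>carrier G. \<forall>h\<in>carrier G. R g h \<longrightarrow> R (x \<otimes> g) (y \<otimes> h))" for x y
  have absorb: "\<beta> (el l (u \<otimes> g)) = el l (c l \<otimes> (v \<otimes> h))"
    if "R g h" "l < r" "l \<noteq> 0" "u \<in> Gp l" "v \<in> Gp l" "v \<in> carrier G" "g \<in> carrier G" "h \<in> carrier G" for l u v g h
  proof -
    have "\<beta> (el l g) = el l (c l \<otimes> h)" using that by (simp add: R_def)
    then show ?thesis using that by (simp add: c_pos el_absorb)
  qed
  \<comment> \<open>Both \<open>a 0 j\<close> and \<open>a j 0\<close> lie in \<open>Gp l\<close>
    for l different from 0 and j, so only the elements of types j and 0 change.\<close>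
  have step1: "R (a 0 j \<otimes> g) (a j 0 \<otimes> h)"
    if R: "R g h" and j: "j < r" "j \<noteq> 0" and gh: "g \<in> carrier G" "h \<in> carrier G" for j g h
  proof -
    let ?g = "a 0 j \<otimes> g" and ?h = "a j 0 \<otimes> h"
    have far: "\<beta> (el l ?g) = el l (c l \<otimes> ?h)" if "l < r" "l \<noteq> 0" "l \<noteq> j" for l
      using absorb[OF R that(1,2)] that j gh by (simp add: a_in_Gp)
    have "\<beta> (el j ?g) = el j ?h"
      using flip[of j 0 g h] R j gh by (simp add: R_def)
    then have at_j: "\<beta> (el j ?g) = el j (c j \<otimes> ?h)"
      using j gh by (simp add: c_pos)
    have "\<beta> (el 0 g) = el 0 (c 0 \<otimes> h)" using R by (simp add: R_def)
    also have "\<dots> = el 0 ?h" using j gh by (intro el_a_indep) simp_all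
    \<comment> \<open>The flip in type 0 is read backwards: \<open>el 0 g\<close> is the 0-neighbour
      seen from \<open>?g\<close>, and its image is already known.\<close>
    also have "el 0 g = el 0 (a j 0 \<otimes> ?g)" using j gh by (simp add: a_mult_assoc)
    finally have "\<beta> (el 0 ?g) = el 0 (c 0 \<otimes> ?h)"
      using flip[of 0 j ?g ?h] far at_j j gh by (metis a_closed a_self l_one m_closed zero_less_r)
    then show ?thesis using far at_j by (auto simp: R_def)
  qed
  \<comment> \<open>The inverse move, so the flips come in the opposite order: first type 0, then
    type j.\<close>
  have step2: "R (a j 0 \<otimes> g) (a 0 j \<otimes> h)"
    if R: "R g h" and j: "j < r" "j \<noteq> 0" and gh: "g \<in> carrier G" "h \<in> carrier G" for j g h
  proof -
    let ?g = "a j 0 \<otimes> g" and ?h = "a 0 j \<otimes> h"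
    have far: "\<beta> (el l ?g) = el l (c l \<otimes> ?h)" if "l < r" "l \<noteq> 0" "l \<noteq> j" for l
      using absorb[OF R that(1,2)] that j gh by (simp add: a_in_Gp)
    have "\<beta> (el 0 ?g) = el 0 h"
      using flip[of 0 j g h] R j gh by (simp add: R_def)
    also have "\<dots> = el 0 (c 0 \<otimes> ?h)"
      using j gh by (simp add: a_mult_assoc el_a_absorb)
    finally have at_0: "\<beta> (el 0 ?g) = el 0 (c 0 \<otimes> ?h)" .
    have "\<beta> (el j (a 0 j \<otimes> ?g)) = el j (a j 0 \<otimes> ?h)"
      using R j gh by (simp add: R_def c_pos a_mult_assoc)
    then have "\<beta> (el j ?g) = el j (c j \<otimes> ?h)"
      using flip[of j 0 ?g ?h] far at_0 j gh by (metis a_closed m_closed zero_less_r)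
    then show ?thesis using far at_0 by (auto simp: R_def)
  qed
  have Q1: "Q (a 0 j) (a j 0)" "Q (a j 0) (a 0 j)" if "j < r" for j
    using that step1[OF _ that] step2[OF _ that] by (cases "j = 0"; simp add: Q_def)+
  have Q_mult: "Q (x \<otimes> x') (y \<otimes> y')" if "Q x y" "Q x' y'" for x x' y y'
    using that by (simp add: Q_def m_assoc)
  have ex_y: "\<exists>y. Q x y" if "x \<in> carrier G" for x
  proof -
    have "x \<in> H I" "I \<subseteq> I" using that by (simp_all add: H_I)
    then show ?thesis
    proof (induction rule: H_induct)
      case one
      show ?case using Q1[of 0] by auto
    next
      case (gen i j)
      then have "a i j = a i 0 \<otimes> a 0 j" by (simp add: a_mult)
      then show ?case using Q_mult[OF Q1(2)[of i] Q1(1)[of j]] gen by auto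
    qed (use Q_mult in blast)
  qed
  have ex_x: "\<exists>x. Q x y" if "y \<in> carrier G" for y
  proof -
    have "y \<in> H I" "I \<subseteq> I" using that by (simp_all add: H_I)
    then show ?thesis
    proof (induction rule: H_induct)
      case one
      show ?case using Q1[of 0] by auto
    next
      case (gen i j)
      then have "a i j = a i 0 \<otimes> a 0 j" by (simp add: a_mult)
      then show ?case using Q_mult[OF Q1(1)[of i] Q1(2)[of j]] gen by auto
    qed (use Q_mult in blast)
  qed
  \<comment> \<open>Positive types suffice to determine an element of G, and for them
    \<open>c k\<close> is \<one>.\<close>
  have cancel: "x = y" if "x \<in> carrier G" "y \<in> carrier G" "\<And>k. 0 < k \<Longrightarrow> k < r \<Longrightarrow> el k x = el k y" for x y
  proof -
    have "x \<otimes> inv y = \<one>"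
      using that el_eq_iff by (intro Inter_Gp_trivial[of 0]) auto
    then show ?thesis using that by (metis inv_equality inv_inv inv_closed)
  qed
  have "R \<one> \<one>"
    unfolding R_def
  proof (intro allI impI)
    fix k assume k: "k < r"
    then have "\<beta> (el k \<one>) \<in> adj_chamber \<one>" unfolding \<beta>_base[symmetric] by (simp add: base_flag_def)
    then obtain l where "\<beta> (el k \<one>) = el l (c l \<otimes> \<one>)" by (auto simp: adj_chamber_def)
    moreover have "fst (\<beta> (el k \<one>)) = k" using \<beta> k by (simp add: mem_AutI el_in_elems)
    ultimately show "\<beta> (el k \<one>) = el k (c k \<otimes> \<one>)" by simp
  qed
  \<comment> \<open>Applying \<open>Q x y\<close> to the given pair of chambers reads off the images
    of the elements \<open>el k x\<close> from y. Hence each of x and y determines the other, and Q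
    is the graph of a bijection.\<close>
  then have QR: "R x y" if "Q x y" for x y
    using that unfolding Q_def by (metis one_closed r_one)
  have uniq_y: "y = y'" if "Q x y" "Q x y'" for x y y'
  proof (rule cancel)
    fix k assume k: "0 < k" "k < r"
    have "el k (c k \<otimes> y) = el k (c k \<otimes> y')"
      using QR[OF \<open>Q x y\<close>] QR[OF \<open>Q x y'\<close>] k unfolding R_def by metis
    then show "el k y = el k y'" using \<open>Q x y\<close> \<open>Q x y'\<close> k by (simp add: Q_def c_pos)
  qed (use that in \<open>simp_all add: Q_def\<close>)
  have uniq_x: "x = x'" if "Q x y" "Q x' y" for x x' y
  proof (rule cancel)
    fix k assume k: "0 < k" "k < r"
    have "\<beta> (el k x) = \<beta> (el k x')"
      using QR[OF \<open>Q x y\<close>] QR[OF \<open>Q x' y\<close>] k unfolding R_def by metis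
    then show "el k x = el k x'"
      using \<open>Q x y\<close> \<open>Q x' y\<close> k by (simp add: inj Q_def el_in_elems)
  qed (use that in \<open>simp_all add: Q_def\<close>)
  define \<phi> where "\<phi> = (\<lambda>x\<in>carrier G. THE y. Q x y)"
  have \<phi>: "\<phi> x = y" if "Q x y" for x y
    using that uniq_y unfolding \<phi>_def by (auto simp: Q_def intro!: the_equality)
  have Q\<phi>: "Q x (\<phi> x)" if "x \<in> carrier G" for x
    using ex_y[OF that] \<phi> by auto
  have "\<phi> \<in> hom G G"
  proof (rule homI)
    show "\<phi> x \<in> carrier G" if "x \<in> carrier G" for x using Q\<phi>[OF that] by (simp add: Q_def)
    show "\<phi> (x \<otimes> y) = \<phi> x \<otimes> \<phi> y" if "x \<in> carrier G" "y \<in> carrier G" for x y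
      using Q_mult[OF Q\<phi> Q\<phi>] that by (simp add: \<phi>)
  qed
  moreover have "bij_betw \<phi> (carrier G) (carrier G)"
  proof (rule bij_betwI')
    show "\<phi> x = \<phi> y \<longleftrightarrow> x = y" if "x \<in> carrier G" "y \<in> carrier G" for x y
      using Q\<phi>[OF that(1)] Q\<phi>[OF that(2)] uniq_x by metis
    show "\<phi> x \<in> carrier G" if "x \<in> carrier G" for x using Q\<phi>[OF that] by (simp add: Q_def)
    show "\<exists>x\<in>carrier G. y = \<phi> x" if "y \<in> carrier G" for y
      using ex_x[OF that] \<phi> by (auto simp: Q_def)
  qed
  ultimately have "\<phi> \<in> auto G" by (simp add: auto_def Bij_def \<phi>_def)
  moreover have "\<forall>x\<in>\<alpha> ` {1..<r}. \<phi> x = inv x"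
  proof
    fix x assume "x \<in> \<alpha> ` {1..<r}"
    then obtain j where "j \<in> {1..<r}" "x = \<alpha> j" by blast
    then have "j < r" "x = a 0 j" by (simp_all add: a_zero)
    then show "\<phi> x = inv x" using \<phi>[OF Q1(1)] by (simp add: a_inv)
  qed
  ultimately show ?thesis by blast
qed

section \<open>Orbits of chambers\<close>

lemma right_mult_AutI:
  assumes g: "g \<in> carrier G"
  shows "restrict (right_mult G g) (elems \<Gamma>) \<in> carrier (AutI \<Gamma>)"
proof -
  let ?X = "elems \<Gamma>" and ?m = "right_mult G"
  have closed: "?m h x \<in> ?X" and type: "fst (?m h x) = fst x"
    and inverse: "?m (inv h) (?m h x) = x" "?m h (?m (inv h) x) = x"
    if "x \<in> ?X" "h \<in> carrier G" for x h
  proof -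
    obtain k g where "k < r" "g \<in> carrier G" "x = el k g" using \<open>x \<in> ?X\<close> elems_iff by metis
    then show "?m h x \<in> ?X" "fst (?m h x) = fst x" "?m (inv h) (?m h x) = x" "?m h (?m (inv h) x) = x"
      using \<open>h \<in> carrier G\<close> by (simp_all add: right_mult_el el_in_elems m_assoc)
  qed
  have "bij_betw (?m g) ?X ?X"
    by (rule bij_betw_byWitness[where f' = "?m (inv g)"]) (use closed inverse g in auto)
  then have "bij_betw (restrict (?m g) ?X) ?X ?X"
    by (rule bij_betw_cong[THEN iffD1, rotated]) simp
  moreover have "inc x y \<longleftrightarrow> inc (?m g x) (?m g y)" if "x \<in> ?X" "y \<in> ?X" for x y
  proof -
    obtain k h l h' where "k < r" "h \<in> carrier G" "x = el k h" "l < r" "h' \<in> carrier G" "y = el l h'"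
      using \<open>x \<in> ?X\<close> \<open>y \<in> ?X\<close> elems_iff by metis
    then show ?thesis using g by (simp add: right_mult_el inc_mult)
  qed
  ultimately show ?thesis using type g by (simp add: mem_AutI Bij_def)
qed

abbreviation orb :: "(nat \<times> 'a set) set \<Rightarrow> (nat \<times> 'a set) set set" where
  "orb \<equiv> orbit (AutI \<Gamma>) (chamber_action \<Gamma>)"

lemma orb_translate:
  assumes g: "g \<in> carrier G"
  shows "orb (base_flag I g) = orb (base_flag I \<one>)" and "orb (adj_chamber g) = orb (adj_chamber \<one>)"
proof -
  have "restrict (right_mult G g) (elems \<Gamma>) ` base_flag I \<one> = base_flag I g"
    unfolding base_flag_def image_image using g
    by (intro image_cong) (simp_all add: el_in_elems right_mult_el)
  then show "orb (base_flag I g) = orb (base_flag I \<one>)"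
    by (intro chamber_orbit_eq[OF right_mult_AutI[OF g]]) (simp_all add: base_chamber)
  have "restrict (right_mult G g) (elems \<Gamma>) ` adj_chamber \<one> = adj_chamber g"
    unfolding adj_chamber_def image_image using g
    by (intro image_cong) (simp_all add: el_in_elems right_mult_el)
  then show "orb (adj_chamber g) = orb (adj_chamber \<one>)"
    by (intro chamber_orbit_eq[OF right_mult_AutI[OF g]]) (simp_all add: adj_chamber_in_chambers)
qed

text \<open>The k-neighbour of \<open>base_flag I g\<close> is the \<open>adj_chamber h\<close> with
  \<open>a k 0 \<otimes> h\<close> = g, which gives h = \<open>a 0 k \<otimes> g\<close>.\<close>

lemma chamber_cases:
  assumes bt: "base_thin k" and k: "k < r" and g: "g \<in> carrier G"
    and C: "C \<in> chambers \<Gamma>" and sub: "base_flag (I - {k}) g \<subseteq> C"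
  shows "C = base_flag I g \<or> C = adj_chamber (a 0 k \<otimes> g)"
proof -
  have fC: "flag \<Gamma> C" "fst ` C = I" using C by (simp_all add: chambers_G)
  then obtain x where x: "x \<in> C" "fst x = k" using k by (metis atLeastLessThan_iff image_iff le0)
  then have "x \<in> elems \<Gamma>" using fC by (auto simp: flag_def)
  then obtain h where h: "h \<in> carrier G" "x = el k h" using x(2) by (auto simp: elems_iff)
  have "inc (el k h) (el j g)" if "j < r" "j \<noteq> k" for j
  proof -
    have "el j g \<in> C" using sub that by (auto simp: base_flag_def)
    then show ?thesis using fC(1) x(1) h by (simp add: flag_def)
  qed
  then have xs: "x = el k g \<or> x = el k (a (other k) k \<otimes> g)"
    using base_thinD[OF bt k g h(1), of "other k"] h by simp
  have "C \<subseteq> insert x (base_flag (I - {k}) g)"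
  proof
    fix y assume y: "y \<in> C"
    show "y \<in> insert x (base_flag (I - {k}) g)"
    proof (cases "fst y = k")
      case True
      then show ?thesis using flag_inj[OF fC(1) x(1) y] x(2) by simp
    next
      case False
      then have j: "fst y \<in> I - {k}" using fC(2) y by blast
      then have z: "el (fst y) g \<in> base_flag (I - {k}) g" by (simp add: base_flag_def)
      then have "y = el (fst y) g" using flag_inj[OF fC(1) y subsetD[OF sub z]] by simp
      then show ?thesis using z by simp
    qed
  qed
  then have "C = insert x (base_flag (I - {k}) g)" using x(1) sub by blast
  moreover have "adj_chamber (a 0 k \<otimes> g) = insert (el k (a (other k) k \<otimes> g)) (base_flag (I - {k}) g)"
    using adj_chamber_insert[of k "a 0 k \<otimes> g"] k g by (simp add: a_mult_assoc)
  ultimately show ?thesis using xs base_flag_insert[OF k, of g] by (elim disjE) simp_all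
qed

text \<open>Translations are automorphisms, so there are at most two orbits, and an automorphism
  merging them would yield a group automorphism excluded by the last hypothesis. Two adjacent
  chambers are the two completions of one flag of corank one: a translate of the base chamber and a
  translate of its neighbour.\<close>

lemma chiralI:
  assumes nt: "carrier G \<noteq> {\<one>}" and bt: "\<And>k. k < r \<Longrightarrow> base_thin k"
    and tr: "\<And>k. k < r \<Longrightarrow> trans_on (I - {k})"
    and no: "\<not> (\<exists>\<phi>\<in>auto G. \<forall>x\<in>\<alpha> ` {1..<r}. \<phi> x = inv x)"
  shows "chiral \<Gamma>"
proof -
  interpret A: group_action "AutI \<Gamma>" "chambers \<Gamma>" "chamber_action \<Gamma>"
    by (rule chamber_action_group_action)
  have neq: "orb (base_flag I \<one>) \<noteq> orb (adj_chamber \<one>)"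
  proof
    assume "orb (base_flag I \<one>) = orb (adj_chamber \<one>)"
    then have "adj_chamber \<one> \<in> orb (base_flag I \<one>)" using A.orbit_refl[OF adj_chamber_in_chambers[of \<one>]] by simp
    then obtain \<beta> where "\<beta> \<in> carrier (AutI \<Gamma>)" "\<beta> ` base_flag I \<one> = adj_chamber \<one>"
      using base_chamber[of \<one>] by (auto simp: orbit_def chamber_action_def)
    then show False using inverting_automorphism[OF nt bt] no by blast
  qed
  have sub: "\<exists>g\<in>carrier G. E = base_flag (I - {k}) g"
    if "flag \<Gamma> C" "E \<subseteq> C" "fst ` E = I - {k}" "k < r" for C E k
    using trans_onD[OF tr[OF that(4)] flag_subset[OF that(1,2)] that(3)] .
  have "orb C = orb (base_flag I \<one>) \<or> orb C = orb (adj_chamber \<one>)" if C: "C \<in> chambers \<Gamma>" for C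
  proof -
    let ?E = "{x \<in> C. fst x \<noteq> 0}"
    have fC: "flag \<Gamma> C" "fst ` C = I" using C by (simp_all add: chambers_G)
    have "fst ` ?E = fst ` C - {0}" by auto
    then have "fst ` ?E = I - {0}" using fC(2) by simp
    then obtain g where g: "g \<in> carrier G" "?E = base_flag (I - {0}) g"
      using sub[OF fC(1), of ?E 0] by auto
    then have "C = base_flag I g \<or> C = adj_chamber (a 0 0 \<otimes> g)"
      using chamber_cases[OF bt[of 0] _ g(1) C] g(2)[symmetric] by simp
    then show ?thesis
      using orb_translate(1)[OF g(1)] orb_translate(2)[of "a 0 0 \<otimes> g"] g(1) by (elim disjE) simp_all
  qed
  then have "orbits (AutI \<Gamma>) (chambers \<Gamma>) (chamber_action \<Gamma>) = {orb (base_flag I \<one>), orb (adj_chamber \<one>)}"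
    using base_chamber[of \<one>] adj_chamber_in_chambers[of \<one>] by (auto simp: orbits_def)
  then have "card (orbits (AutI \<Gamma>) (chambers \<Gamma>) (chamber_action \<Gamma>)) = 2" using neq by simp
  moreover have "orb C \<noteq> orb D" if CD: "C \<in> chambers \<Gamma>" "D \<in> chambers \<Gamma>" "adjacent C D" for C D
  proof -
    have fC: "flag \<Gamma> C" "fst ` C = I" using CD by (simp_all add: chambers_G)
    obtain x where x: "C - D = {x}" using CD(3) by (auto simp: adjacent_def card_1_singleton_iff)
    obtain k where k: "k < r" "fst x = k" using x fC(2) by fastforce
    have "fst ` (C \<inter> D) = I - {k}"
    proof -
      have "C \<inter> D = C - {x}" using x by blast
      moreover have "fst ` (C - {x}) = fst ` C - fst ` {x}"
        using x by (intro inj_on_image_set_diff[where C = C] inj_onI flag_inj[OF fC(1)]) auto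
      ultimately show ?thesis using fC(2) k(2) by simp
    qed
    then obtain g where g: "g \<in> carrier G" "C \<inter> D = base_flag (I - {k}) g"
      using sub[OF fC(1), of "C \<inter> D" k] k(1) by auto
    have "C = base_flag I g \<or> C = adj_chamber (a 0 k \<otimes> g)" "D = base_flag I g \<or> D = adj_chamber (a 0 k \<otimes> g)"
      using chamber_cases[OF bt[OF k(1)] k(1) g(1)] CD(1,2) g(2) by (metis Int_lower1 Int_lower2)+
    moreover have "C \<noteq> D" using x by blast
    ultimately show ?thesis
      using neq orb_translate(1)[OF g(1)] orb_translate(2)[of "a 0 k \<otimes> g"] g(1) k(1)
      by (elim disjE) simp_all
  qed
  ultimately show ?thesis unfolding chiral_def by blast
qed

subsection \<open>Residual connectedness\<close>

text \<open>A chamber that shares all elements but that of type k with the base chamber is a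
  translate g of the base chamber outside type k0. Thinness at k0 leaves two possibilities for the
  position of the base element of type k0 relative to g, and in each of them rigidity determines
  g.\<close>

lemma base_thin_transfer:
  assumes tr: "trans_on (I - {k0})" and bt: "base_thin k0" and k0: "k0 < r" and k: "k < r"
  shows "base_thin k"
proof (cases "k = k0")
  case True
  then show ?thesis using bt by simp
next
  case False
  show ?thesis unfolding base_thin_def
  proof (intro ballI impI)
    fix h assume h: "h \<in> carrier G" "\<forall>j<r. j \<noteq> k \<longrightarrow> inc (el k h) (el j \<one>)"
    let ?C = "insert (el k h) (base_flag (I - {k}) \<one>)"
    let ?E = "{x \<in> ?C. fst x \<noteq> k0}"
    have "flag \<Gamma> ?C"
      using h k by (intro flag_insert flag_base el_in_elems) (auto simp: base_flag_def)
    then have C: "inc x y" if "x \<in> ?C" "y \<in> ?C" for x y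
      using that unfolding flag_def by blast
    have E: "flag \<Gamma> ?E" using \<open>flag \<Gamma> ?C\<close> by (rule flag_subset) auto
    have "fst ` {x \<in> C. fst x \<noteq> k0} = fst ` C - {k0}" for C :: "(nat \<times> 'a set) set" by auto
    moreover have "fst ` ?C = I" using k by auto
    ultimately have "fst ` ?E = I - {k0}" by (simp only:)
    then obtain g where g: "g \<in> carrier G" "?E = base_flag (I - {k0}) g"
      using trans_onD[OF tr E] by blast
    have in_E: "el j g \<in> ?E" if "j < r" "j \<noteq> k0" for j
      unfolding g(2) using that by (simp add: base_flag_def)
    have same: "el j x = el j g" if "el j x \<in> ?E" for j x
    proof -
      have "el j x \<in> base_flag (I - {k0}) g" using that unfolding g(2) .
      then obtain i where i: "el j x = el i g" by (auto simp: base_flag_def)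
      then have "j = i" by (metis fst_el)
      then show ?thesis using i by simp
    qed
    have hk: "el k h = el k g" using False by (intro same) simp
    have h1: "el j \<one> = el j g" if "j < r" "j \<noteq> k" "j \<noteq> k0" for j
      using that by (intro same) (simp add: base_flag_def)
    have "inc (el k0 \<one>) (el j g)" if "j < r" "j \<noteq> k0" for j
      using in_E[OF that] False k0 by (intro C) (auto simp: base_flag_def)
    then have "el k0 \<one> = el k0 g \<or> el k0 \<one> = el k0 (a k k0 \<otimes> g)"
      using base_thinD[OF bt k0 g(1) _ k False] by simp
    then show "el k h = el k \<one> \<or> el k h = el k (a (other k) k)"
    proof
      assume "el k0 \<one> = el k0 g"
      then have "el j g = el j \<one>" if "j < r" "j \<noteq> k" for j
        using h1[of j] that by (cases "j = k0") simp_all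
      then have "g = \<one>"
        using el_eq_iff[of _ g \<one>] k g(1) by (intro Inter_Gp_trivial[of k]) simp_all
      then show ?thesis using hk by simp
    next
      \<comment> \<open>The second possibility: passing from g to its neighbour restores agreement
        with \<one> in type k0 and spoils nothing outside type k. So \<open>?g\<close> is \<one>, g
        is \<open>a k0 k\<close>, and h represents the other k-neighbour.\<close>
      let ?g = "a k k0 \<otimes> g"
      assume k0g: "el k0 \<one> = el k0 ?g"
      have "el j ?g = el j \<one>" if "j < r" "j \<noteq> k" for j
      proof (cases "j = k0")
        case True
        then show ?thesis using k0g by simp
      next
        case False
        then show ?thesis using h1[of j] that k k0 g(1) by (simp add: el_a_absorb)
      qed
      then have "?g = \<one>"
        using el_eq_iff[of _ ?g \<one>] k k0 g(1) by (intro Inter_Gp_trivial[of k]) simp_all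
      then have "a k0 k = a k0 k \<otimes> ?g" using k k0 by simp
      also have "\<dots> = g" using k k0 g(1) by (simp add: a_mult_assoc)
      finally have "el k h = el k (a k0 k)" using hk by simp
      then show ?thesis using el_a_indep[of k0 "other k" k \<one>] k k0 False by simp
    qed
  qed
qed

lemma residually_connectedI:
  assumes geo: "geometry \<Gamma>" and tr: "\<And>k. k < r \<Longrightarrow> trans_on (I - {k})"
  shows "residually_connected \<Gamma>"
proof -
  have tr': "trans_on J" if "J \<subset> I" for J
  proof -
    obtain k where "k \<in> I - J" using psubset_imp_ex_mem[OF \<open>J \<subset> I\<close>] by blast
    then show ?thesis using that by (intro trans_on_subset[OF geo tr[of k]]) auto
  qed
  have "connected_incidence_graph (residue \<Gamma> F)"
    if F: "flag \<Gamma> F" "2 \<le> card (I - fst ` F)" for F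
  proof -
    define J where "J = fst ` F"
    let ?K = "I - J" and ?R = "residue \<Gamma> F"
    have "J \<subseteq> I" using flag_types[OF F(1)] by (simp add: J_def)
    moreover have "J \<noteq> I" using F(2) J_def by (metis Diff_cancel card.empty not_numeral_le_zero)
    ultimately have JI: "J \<subset> I" "J \<subseteq> I" by blast+
    interpret K: subgroup "H ?K" G by (rule H_subgroup) auto
    obtain g where g: "g \<in> carrier G" "F = base_flag J g"
      using trans_onD[OF tr'[OF JI(1)] F(1) J_def[symmetric]] by blast
    have res: "x \<in> elems ?R \<longleftrightarrow>
        (\<exists>k\<in>?K. \<exists>h\<in>carrier G. x = el k h \<and> (\<forall>j\<in>J. inc (el k h) (el j g)))" for x
      using elems_residue_base_flag[OF JI(2) g(1), of x] g(2) by simp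
    let ?N = "(incidence_graph_edges ?R)\<^sup>*"
    have link: "(x, y) \<in> ?N" if "x \<in> elems ?R" "y \<in> elems ?R" "inc x y" for x y
      using that by (cases "x = y") (auto simp: residue_edges)
    have in_res: "el k (v \<otimes> g) \<in> elems ?R" if "k \<in> ?K" "v \<in> H ?K" for k v
    proof -
      have v: "v \<in> carrier G" using that(2) by simp
      have "inc (el k (v \<otimes> g)) (el j g)" if "j \<in> J" for j
      proof -
        have "el j (v \<otimes> g) = el j g"
          using base_flag_eq_H[OF JI(2) \<open>v \<in> H ?K\<close> g(1)] that by (simp add: base_flag_eq_iff)
        then show ?thesis
          using inc_common[of k j "v \<otimes> g"] v g(1) \<open>k \<in> ?K\<close> \<open>j \<in> J\<close> JI by auto
      qed
      then show ?thesis unfolding res using that v g(1) by blast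
    qed
    \<comment> \<open>The starting point v is quantified inside the induction so that walks compose:
      for a product of x and y, the walk for y starts at v and the walk for x at
      \<open>y \<otimes> v\<close>.\<close>
    have walk: "\<forall>v\<in>H ?K. \<forall>k\<in>?K. \<forall>l\<in>?K. (el k (v \<otimes> g), el l (u \<otimes> v \<otimes> g)) \<in> ?N"
      if "u \<in> H ?K" for u
    proof -
      have "u \<in> H ?K" "?K \<subseteq> I" using that by auto
      then show ?thesis
      proof (induction rule: H_induct)
        case one
        then show ?case using g(1) by (auto intro!: link in_res inc_common)
      next
        case (gen i j)
        show ?case
        proof (intro ballI)
          fix v k l assume v: "v \<in> H ?K" and kl: "k \<in> ?K" "l \<in> ?K"
          let ?v = "v \<otimes> g" and ?w = "a i j \<otimes> v \<otimes> g"
          have w: "a i j \<otimes> v \<in> H ?K" using a_in_H[OF gen] v by simp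
          have vc: "v \<in> carrier G" using v by simp
          have r: "i < r" "j < r" "k < r" "l < r" using gen kl by auto
          have "(el k ?v, el i ?v) \<in> ?N"
            using gen kl v vc r g(1) by (intro link in_res inc_common) simp_all
          moreover have "(el i ?v, el j ?w) \<in> ?N"
          proof (cases "i = j")
            case True
            then show ?thesis using r vc by simp
          next
            case False
            then show ?thesis
              using inc_a[of i j ?v] gen v w vc r g(1) by (intro link in_res) (simp_all add: m_assoc)
          qed
          moreover have "(el j ?w, el l ?w) \<in> ?N"
            using gen kl w vc r g(1) by (intro link in_res inc_common) simp_all
          ultimately show "(el k ?v, el l ?w) \<in> ?N" by (meson rtrancl_trans)
        qed
      next
        case (mult x y)
        show ?case
        proof (intro ballI)
          fix v k l assume v: "v \<in> H ?K" and kl: "k \<in> ?K" "l \<in> ?K"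
          have "(el k (v \<otimes> g), el k (y \<otimes> v \<otimes> g)) \<in> ?N"
            using mult v kl by blast
          moreover have "(el k (y \<otimes> v \<otimes> g), el l (x \<otimes> (y \<otimes> v) \<otimes> g)) \<in> ?N"
            using mult v kl by blast
          ultimately show "(el k (v \<otimes> g), el l (x \<otimes> y \<otimes> v \<otimes> g)) \<in> ?N"
            using mult(1,2) v by (simp add: m_assoc)
        qed
      qed
    qed
    \<comment> \<open>Together with F, x forms a flag of type \<open>insert k J\<close>, which is
      still proper because the residue has rank at least two. So this flag is a translate by some
      g', and g' and g agree on J; their quotient lies in \<open>H ?K\<close> by
      \<open>Inter_Gp\<close>.\<close>
    have rep: "\<exists>k\<in>?K. \<exists>u\<in>H ?K. x = el k (u \<otimes> g)" if x: "x \<in> elems ?R" for x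
    proof -
      obtain k h where k: "k \<in> ?K" "h \<in> carrier G" "x = el k h" "\<forall>j\<in>J. inc (el k h) (el j g)"
        using x unfolding res by blast
      have fl: "flag \<Gamma> (insert x F)"
        using k by (intro flag_insert[OF F(1)]) (auto simp: g base_flag_def el_in_elems)
      have types: "fst ` insert x F = insert k J" using k by (simp add: J_def)
      have "card (?K - {k}) \<noteq> 0"
        using F(2) k(1) by (simp add: J_def card_Diff_singleton)
      then have "?K - {k} \<noteq> {}" by (metis card.empty)
      then have "insert k J \<subset> I" using k(1) JI by auto
      then obtain g' where g': "g' \<in> carrier G" "insert x F = base_flag (insert k J) g'"
        using trans_onD[OF tr' fl types] by blast
      have same: "y = el (fst y) g'" if y: "y \<in> insert x F" for y
      proof -
        have "fst y \<in> insert k J" using types y by blast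
        then have "el (fst y) g' \<in> insert x F" unfolding g'(2) base_flag_def by (rule imageI)
        then show ?thesis using flag_inj[OF fl y] by simp
      qed
      have "g' \<otimes> inv g \<in> H ?K"
      proof (rule Inter_Gp[OF JI(1)])
        fix j assume j: "j \<in> J"
        then have "el j g \<in> insert x F" by (simp add: g base_flag_def)
        then have "el j g = el j g'" using same by fastforce
        then show "g' \<otimes> inv g \<in> Gp j" using el_eq_iff[of j g' g] j JI g g' by auto
      qed (use g g' in simp)
      moreover have "x = el k (g' \<otimes> inv g \<otimes> g)"
        using same[of x] k g(1) g'(1) by (simp add: m_assoc)
      ultimately show ?thesis using k(1) by blast
    qed
    show ?thesis unfolding connected_incidence_graph_def
    proof (intro ballI)
      fix x y assume "x \<in> elems ?R" "y \<in> elems ?R"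
      then obtain k u l w where x: "k \<in> ?K" "u \<in> H ?K" "x = el k (u \<otimes> g)"
        and y: "l \<in> ?K" "w \<in> H ?K" "y = el l (w \<otimes> g)" using rep by meson
      then have "(el k (u \<otimes> g), el l (w \<otimes> inv u \<otimes> u \<otimes> g)) \<in> ?N"
        using walk[of "w \<otimes> inv u"] by simp
      then show "(x, y) \<in> ?N" using x y by (simp add: m_assoc)
    qed
  qed
  then show ?thesis by (simp add: residually_connected_def rank_residue)
qed

section \<open>The characterisation of chiral hypertopes\<close>

theorem chiral_hypertope_iff:
  assumes geo: "geometry \<Gamma>"
  shows "chiral_hypertope \<Gamma> \<longleftrightarrow>
     (\<forall>k\<in>I. transitive_on_chambers G (truncation (I - {k}) \<Gamma>)) \<and>
     (\<forall>T. T \<subseteq> I \<and> card T = r - 1 \<longrightarrow> (\<Inter>t\<in>T. Gp t) = {\<one>}) \<and>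
     (\<exists>k\<in>I. twice_as_large G (\<Inter>j\<in>I - {k}. Gp k <#> Gp j) (Gp k)) \<and>
     \<not> (\<exists>\<phi>\<in>auto G. \<forall>a\<in>\<alpha> ` {1..<r}. \<phi> a = inv a)"
    (is "_ \<longleftrightarrow> ?i \<and> ?ii \<and> ?iii \<and> ?iv")
proof -
  have i: "?i \<longleftrightarrow> (\<forall>k<r. trans_on (I - {k}))"
    using transitive_truncation_iff[of "I - {_}"] by auto
  \<comment> \<open>Condition (iii) is also what excludes the trivial group: its only coset gives
    cardinality one instead of two.\<close>
  have iii: "?iii \<longleftrightarrow> (\<exists>k<r. carrier G \<noteq> {\<one>} \<and> base_thin k)"
    using twice_as_large_iff by auto
  have ii: ?ii
  proof (intro allI impI, elim conjE)
    fix T assume T: "T \<subseteq> I" "card T = r - 1"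
    then have "card (I - T) = 1" using r3 by (simp add: card_Diff_subset finite_subset)
    then obtain k where k: "I - T = {k}" by (auto simp: card_1_singleton_iff)
    then have "k < r" by (metis DiffD1 atLeastLessThan_iff singletonI)
    show "(\<Inter>t\<in>T. Gp t) = {\<one>}"
    proof (intro equalityI subsetI)
      fix x assume x: "x \<in> (\<Inter>t\<in>T. Gp t)"
      have "T \<noteq> {}" using T(2) r3 by auto
      then obtain t where "t \<in> T" by blast
      then have "t \<in> T" "t < r" using T(1) by auto
      then have "x \<in> carrier G" using x subgroup.mem_carrier[OF Gp_subgroup] by auto
      moreover have "x \<in> Gp j" if "j < r" "j \<noteq> k" for j
      proof -
        have "j \<notin> I - T" unfolding k using that(2) by simp
        then have "j \<in> T" using that(1) by simp
        then show ?thesis using x by blast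
      qed
      ultimately show "x \<in> {\<one>}" using Inter_Gp_trivial[OF \<open>k < r\<close>, of x] by simp
    next
      fix x assume "x \<in> {\<one>}"
      moreover have "\<one> \<in> Gp t" if "t \<in> T" for t
        using that T(1) by (intro subgroup.one_closed Gp_subgroup) auto
      ultimately show "x \<in> (\<Inter>t\<in>T. Gp t)" by blast
    qed
  qed
  show ?thesis
  proof
    assume "chiral_hypertope \<Gamma>"
    then have thin: "thin \<Gamma>" and rc: "residually_connected \<Gamma>" and ch: "chiral \<Gamma>"
      by (auto simp: chiral_hypertope_def hypertope_def)
    have nt: "carrier G \<noteq> {\<one>}" and bt: "\<And>k. k < r \<Longrightarrow> base_thin k"
      using thinD[OF thin] zero_less_r by blast+
    have "trans_on (I - {k})" if "k < r" for k
    proof (rule trans_onI[OF rc bt])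
      have "k \<in> I" using that by simp
      then show "I - {k} \<subset> I" by blast
    qed
    moreover have ?iv
      using not_chiral_if_inverting[OF nt] ch by fastforce
    ultimately show "?i \<and> ?ii \<and> ?iii \<and> ?iv"
      using i ii iii nt bt zero_less_r by blast
  next
    assume R: "?i \<and> ?ii \<and> ?iii \<and> ?iv"
    then have tr: "trans_on (I - {k})" if "k < r" for k using i that by blast
    obtain k0 where k0: "k0 < r" "base_thin k0" and nt: "carrier G \<noteq> {\<one>}"
      using R iii by blast
    have bt: "base_thin k" if "k < r" for k
      using base_thin_transfer[OF tr[OF k0(1)] k0(2,1) that] .
    have "chiral \<Gamma>" using chiralI[OF nt bt tr] R by blast
    then show "chiral_hypertope \<Gamma>"
      using geo thinI[OF nt bt tr] residually_connectedI[OF geo tr]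
      by (simp add: chiral_hypertope_def hypertope_def)
  qed
qed

end

theorem theorem1p1:
  fixes G :: "('a, 'b) monoid_scheme" and r :: nat and \<alpha> :: "nat \<Rightarrow> 'a"
    and I :: "nat set" and Gp :: "nat \<Rightarrow> 'a set"
    and \<Gamma> :: "(nat \<times> 'a set, nat) incidence_system"
  defines "I \<equiv> {0..<r}"
    and "Gp \<equiv> Gplus_sub G r \<alpha>"
    and "\<Gamma> \<equiv> coset_system G I Gp"
  assumes "r \<ge> 3"
    and "Cplus_group G r \<alpha>"
    and "geometry \<Gamma>"
  shows "chiral_hypertope \<Gamma> \<longleftrightarrow>
     (\<forall>k\<in>I. transitive_on_chambers G (truncation (I - {k}) \<Gamma>)) \<and>
     (\<forall>T. T \<subseteq> I \<and> card T = r - 1 \<longrightarrow> (\<Inter>t\<in>T. Gp t) = {\<one>\<^bsub>G\<^esub>}) \<and>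
     (\<exists>k\<in>I. twice_as_large G (\<Inter>j\<in>I - {k}. Gp k <#>\<^bsub>G\<^esub> Gp j) (Gp k)) \<and>
     \<not> (\<exists>\<phi>\<in>auto G. \<forall>a\<in>\<alpha> ` {1..<r}. \<phi> a = inv\<^bsub>G\<^esub> a)"
proof -
  have "cplus G r \<alpha>"
    using assms by (simp add: cplus_def cplus_axioms_def Cplus_group_def)
  from cplus.chiral_hypertope_iff[OF this] show ?thesis
    using \<open>geometry \<Gamma>\<close> unfolding I_def Gp_def \<Gamma>_def .
qed

end
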